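(* The discrete spectrum of the operator $\mathcal{L}_1$ is contained in $(\lambda_0,2)$ with $\lambda_0=1.3326$.
   Context: $U:[0,\infty)\to\mathbb{R}$ is the degree-one Ginzburg-Landau vortex profile: the smooth solution of $U''+\tfrac1rU'-\tfrac1{r^2}U+(1-U^2)U=0$ with $U(0)=0$, $U(+\infty)=1$, $U'>0$. The operator $$\mathcal{L}_1=-\partial_r^2-\tfrac1r\partial_r+\tfrac1{r^2}-(1-3U^2(r))$$ is considered as a self-adjoint operator on $L^2((0,\infty),r\,dr)$ (equivalently, $\mathcal{H}_1=r^{1/2}\mathcal{L}_1r^{-1/2}=-\partial_r^2+\tfrac{3}{4r^2}-(1-3U^2)$ on $L^2((0,\infty),dr)$, associated with the closure of its quadratic form on $C_c^\infty((0,\infty))$). *)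

theory Defs
  imports "HOL-Analysis.Analysis"
begin

section \<open>Operators on a complex \<open>L\<^sup>2\<close> space\<close>

text \<open>Elements of \<open>L\<^sup>2(M)\<close> are represented by functions; equality in \<open>L\<^sup>2(M)\<close> is equality
  almost everywhere.\<close>

definition L2 :: "'a measure \<Rightarrow> ('a \<Rightarrow> complex) set" where
  "L2 M = {f \<in> borel_measurable M. integrable M (\<lambda>x. (cmod (f x))\<^sup>2)}"

definition L2_inner :: "'a measure \<Rightarrow> ('a \<Rightarrow> complex) \<Rightarrow> ('a \<Rightarrow> complex) \<Rightarrow> complex" where
  "L2_inner M f g = (LINT x|M. f x * cnj (g x))"

definition L2_norm :: "'a measure \<Rightarrow> ('a \<Rightarrow> complex) \<Rightarrow> real" where
  "L2_norm M f = sqrt (LINT x|M. (cmod (f x))\<^sup>2)"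

text \<open>An unbounded operator on \<open>L\<^sup>2(M)\<close> is given by its graph, a relation invariant under
  almost everywhere equality: \<open>T u w\<close> means that \<open>u\<close> lies in the domain of \<open>T\<close> and \<open>T u = w\<close>.\<close>

type_synonym 'a L2_op = "('a \<Rightarrow> complex) \<Rightarrow> ('a \<Rightarrow> complex) \<Rightarrow> bool"

text \<open>The quadratic form of a symmetric operator \<open>A\<close> with domain \<open>D\<close> is
  \<open>t(f, g) = \<langle>A f, g\<rangle>\<close> on \<open>D\<close>. A sequence \<open>\<phi>\<close> in \<open>D\<close> is \<open>t\<close>-convergent to \<open>u\<close> if
  \<open>\<phi>\<^sub>n \<rightarrow> u\<close> in \<open>L\<^sup>2(M)\<close> and \<open>t(\<phi>\<^sub>m - \<phi>\<^sub>n, \<phi>\<^sub>m - \<phi>\<^sub>n) \<rightarrow> 0\<close>. The closure of \<open>t\<close> has as its domain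
  the limits of \<open>t\<close>-convergent sequences, and its value at \<open>(u, v)\<close> is \<open>lim t(\<phi>\<^sub>n, \<psi>\<^sub>n)\<close> for
  any sequences \<open>\<phi>\<close>, \<open>\<psi>\<close> that are \<open>t\<close>-convergent to \<open>u\<close>, \<open>v\<close>.\<close>

definition op_form :: "'a measure \<Rightarrow> (('a \<Rightarrow> complex) \<Rightarrow> 'a \<Rightarrow> complex)
    \<Rightarrow> ('a \<Rightarrow> complex) \<Rightarrow> ('a \<Rightarrow> complex) \<Rightarrow> complex" where
  "op_form M A f g = L2_inner M (A f) g"

definition form_convergent :: "'a measure \<Rightarrow> ('a \<Rightarrow> complex) set
    \<Rightarrow> (('a \<Rightarrow> complex) \<Rightarrow> 'a \<Rightarrow> complex) \<Rightarrow> (nat \<Rightarrow> 'a \<Rightarrow> complex) \<Rightarrow> ('a \<Rightarrow> complex) \<Rightarrow> bool" where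
  "form_convergent M D A \<phi> u \<longleftrightarrow>
     u \<in> L2 M \<and> (\<forall>n. \<phi> n \<in> D) \<and>
     (\<lambda>n. L2_norm M (\<lambda>x. \<phi> n x - u x)) \<longlonglongrightarrow> 0 \<and>
     (\<forall>\<epsilon>>0. \<exists>N. \<forall>m\<ge>N. \<forall>n\<ge>N.
        cmod (op_form M A (\<lambda>x. \<phi> m x - \<phi> n x) (\<lambda>x. \<phi> m x - \<phi> n x)) < \<epsilon>)"

text \<open>The operator associated with the closed form \<open>t\<close> by the representation theorem:
  \<open>T u = w\<close> iff \<open>u\<close> is in the form domain and \<open>t(u, v) = \<langle>w, v\<rangle>\<close> for all \<open>v\<close> in the form
  domain.\<close>

definition form_op :: "'a measure \<Rightarrow> ('a \<Rightarrow> complex) set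
    \<Rightarrow> (('a \<Rightarrow> complex) \<Rightarrow> 'a \<Rightarrow> complex) \<Rightarrow> 'a L2_op" where
  "form_op M D A u w \<longleftrightarrow>
     w \<in> L2 M \<and> (\<exists>\<phi>. form_convergent M D A \<phi> u) \<and>
     (\<forall>v \<phi> \<psi>. form_convergent M D A \<phi> u \<longrightarrow> form_convergent M D A \<psi> v \<longrightarrow>
        (\<lambda>n. op_form M A (\<phi> n) (\<psi> n)) \<longlonglongrightarrow> L2_inner M w v)"

text \<open>The second conjunct says that \<open>T - z\<close> is injective with bounded inverse on its range.\<close>

definition resolvent_set :: "'a measure \<Rightarrow> 'a L2_op \<Rightarrow> complex set" where
  "resolvent_set M T = {z.
     (\<forall>f\<in>L2 M. \<exists>u w. T u w \<and> (AE x in M. w x - z * u x = f x)) \<and>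
     (\<exists>C. \<forall>u w. T u w \<longrightarrow> L2_norm M u \<le> C * L2_norm M (\<lambda>x. w x - z * u x))}"

definition spectrum :: "'a measure \<Rightarrow> 'a L2_op \<Rightarrow> complex set" where
  "spectrum M T = - resolvent_set M T"

definition eigenspace :: "'a measure \<Rightarrow> 'a L2_op \<Rightarrow> complex \<Rightarrow> ('a \<Rightarrow> complex) set" where
  "eigenspace M T z = {u. T u (\<lambda>x. z * u x)}"

definition eigenvalue :: "'a measure \<Rightarrow> 'a L2_op \<Rightarrow> complex \<Rightarrow> bool" where
  "eigenvalue M T z \<longleftrightarrow> (\<exists>u\<in>eigenspace M T z. \<not> (AE x in M. u x = 0))"

definition finite_multiplicity :: "'a measure \<Rightarrow> 'a L2_op \<Rightarrow> complex \<Rightarrow> bool" where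
  "finite_multiplicity M T z \<longleftrightarrow>
     (\<exists>B. finite B \<and> B \<subseteq> eigenspace M T z \<and>
        (\<forall>u\<in>eigenspace M T z. \<exists>c. AE x in M. u x = (\<Sum>b\<in>B. c b * b x)))"

definition discrete_spectrum :: "'a measure \<Rightarrow> 'a L2_op \<Rightarrow> complex set" where
  "discrete_spectrum M T =
     {z. z isolated_in spectrum M T \<and> eigenvalue M T z \<and> finite_multiplicity M T z}"

section \<open>The vortex profile and the operator \<open>\<L>\<^sub>1\<close>\<close>

text \<open>All derivatives are relative to \<open>S\<close>: one-sided at \<open>0\<close> for \<open>S = [0, \<infinity>)\<close>, ordinary ones if
  \<open>S\<close> is open.\<close>

definition smooth_on :: "real set \<Rightarrow> (real \<Rightarrow> 'a::real_normed_vector) \<Rightarrow> bool" where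
  "smooth_on S f \<longleftrightarrow>
     (\<exists>D. D 0 = f \<and>
        (\<forall>k. \<forall>x\<in>S. (D k has_vector_derivative D (Suc k) x) (at x within S)))"

text \<open>Only the values of \<open>U\<close> on \<open>[0, \<infinity>)\<close> matter.\<close>

definition vortex_profile :: "(real \<Rightarrow> real) \<Rightarrow> bool" where
  "vortex_profile U \<longleftrightarrow>
     smooth_on {0..} U \<and>
     (\<exists>U' U''.
        (\<forall>r\<ge>0. (U has_real_derivative U' r) (at r within {0..})) \<and>
        (\<forall>r\<ge>0. (U' has_real_derivative U'' r) (at r within {0..})) \<and>
        (\<forall>r>0. U'' r + 1 / r * U' r - 1 / r\<^sup>2 * U r + (1 - (U r)\<^sup>2) * U r = 0) \<and>
        (\<forall>r\<ge>0. U' r > 0)) \<and>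
     U 0 = 0 \<and> (U \<longlongrightarrow> 1) at_top"

definition radial_measure :: "real measure" where
  "radial_measure = density (restrict_space lborel {0<..}) (\<lambda>r. ennreal r)"

definition test_functions :: "(real \<Rightarrow> complex) set" where
  "test_functions =
     {\<phi>. smooth_on {0<..} \<phi> \<and> (\<exists>K. compact K \<and> K \<subseteq> {0<..} \<and> (\<forall>r. r \<notin> K \<longrightarrow> \<phi> r = 0))}"

definition L1_expr :: "(real \<Rightarrow> real) \<Rightarrow> (real \<Rightarrow> complex) \<Rightarrow> real \<Rightarrow> complex" where
  "L1_expr U \<phi> r =
     - vector_derivative (\<lambda>s. vector_derivative \<phi> (at s)) (at r)
     - of_real (1 / r) * vector_derivative \<phi> (at r)
     + of_real (1 / r\<^sup>2) * \<phi> r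
     - of_real (1 - 3 * (U r)\<^sup>2) * \<phi> r"

text \<open>The unitary map \<open>f \<mapsto> r\<^sup>1\<^sup>/\<^sup>2 f\<close> from \<open>L\<^sup>2((0,\<infinity>), r dr)\<close> onto \<open>L\<^sup>2((0,\<infinity>), dr)\<close> preserves
  the test functions, so this operator is unitarily equivalent to the operator associated with the
  closure of the form of \<open>r\<^sup>1\<^sup>/\<^sup>2 \<L>\<^sub>1 r\<^sup>-\<^sup>1\<^sup>/\<^sup>2\<close> on the test functions.\<close>

definition L1_op :: "(real \<Rightarrow> real) \<Rightarrow> real L2_op" where
  "L1_op U = form_op radial_measure test_functions (L1_expr U)"

end

theory Submission
  imports Defs "HOL-Real_Asymp.Real_Asymp"
begin

text \<open>Every real number above \<open>2\<close> lies in the spectrum, by Weyl sequences of wave packets moving to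
  infinity, where the potential \<open>1 / r\<^sup>2 - 1 + 3 U\<^sup>2\<close> tends to \<open>2\<close>; so an isolated point of the
  spectrum that is real lies below \<open>2\<close>. For the lower bound, an explicit subsolution of the vortex
  equation bounds \<open>U\<close> from below, and the positive comparison function \<open>r e\<^sup>-\<^sup>4\<^sup>r\<^sup>/\<^sup>5\<close> then shows that the
  form of \<open>\<L>\<^sub>1\<close> is at least \<open>1.34 \<parallel>f\<parallel>\<^sup>2\<close>.\<close>

section \<open>The Hilbert space \<open>L\<^sup>2(M)\<close>\<close>

text \<open>Both estimates are made on test functions, and the closure of the form enters at two
  points. The lower bound passes to an eigenfunction along a single approximating sequence. The wave
  packets, however, must lie in the domain of the operator, and \<open>form_op\<close> quantifies
  over all form-convergent sequences; this takes a closability argument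
  (\<open>form_op_extends\<close>). The obstacle for the lower bound is that U has no closed
  formula. A subsolution with rational square turns every inequality about it into positivity of a
  polynomial on a half-line. A comparison function r exp(-b r) cancels the singular term 1/r^2 and
  leaves the potential 3 U^2 - 1 - b^2 + 3 b/r. The term 3 b/r compensates for the smallness of U
  near 0, which favours large b, while the limit 2 - b^2 at infinity favours small b. The choice b =
  4/5 has limit 1.36, which leaves room for 1.34 = 67/50, and this exceeds 1.3326 strictly.\<close>

lemma le_mult_if_le_weighted_mean:
  fixes x a b :: real
  assumes "a \<ge> 0" "b \<ge> 0" and le: "\<And>e. e > 0 \<Longrightarrow> x \<le> (e * a\<^sup>2 + b\<^sup>2 / e) / 2"
  shows "x \<le> a * b"
proof -
  have "x \<le> (a + d) * (b + d)" if "d > 0" for d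
  proof -
    \<comment> \<open>The weighted mean is smallest at e = b/a. The shift by d > 0 keeps this
      quotient defined and positive when a or b vanishes; it is removed at the end by letting d tend
      to 0.\<close>
    let ?e = "(b + d) / (a + d)"
    have pos: "a + d > 0" "b + d > 0" using assms that by auto
    have "x \<le> (?e * a\<^sup>2 + b\<^sup>2 / ?e) / 2"
      using pos by (intro le) auto
    also have "\<dots> \<le> (?e * (a + d)\<^sup>2 + (b + d)\<^sup>2 / ?e) / 2"
      using pos assms that by (intro divide_right_mono add_mono mult_left_mono power_mono) auto
    also have "\<dots> = (a + d) * (b + d)"
      using pos by (simp add: power2_eq_square)
    finally show ?thesis .
  qed
  then have "\<forall>\<^sub>F d in at_right 0. x \<le> (a + d) * (b + d)"
    by (auto simp: eventually_at_right_less eventually_mono[OF eventually_at_right_less])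
  moreover have "((\<lambda>d. (a + d) * (b + d)) \<longlongrightarrow> (a + 0) * (b + 0)) (at_right 0)"
    by (intro tendsto_intros)
  ultimately show ?thesis
    using tendsto_lowerbound[of "\<lambda>d. (a + d) * (b + d)" "a * b" "at_right 0" x] by simp
qed

text \<open>The pointwise input for Cauchy-Schwarz: it survives integration, and the free parameter
  e is optimised only afterwards, by \<open>le_mult_if_le_weighted_mean\<close>. The same scheme
  serves the inner product of L2 and later the form of the operator.\<close>

lemma norm_mult_le_weighted_mean:
  fixes a b :: complex and e :: real
  assumes "e > 0"
  shows "cmod (a * cnj b) \<le> (e * (cmod a)\<^sup>2 + (cmod b)\<^sup>2 / e) / 2"
proof -
  have "0 \<le> (e * cmod a - cmod b)\<^sup>2 / e" using assms by simp
  also have "\<dots> = e * (cmod a)\<^sup>2 + (cmod b)\<^sup>2 / e - 2 * (cmod a * cmod b)"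
    using assms by (simp add: power2_diff field_simps power2_eq_square)
  finally show ?thesis by (simp add: norm_mult)
qed

lemma L2_D:
  assumes "f \<in> L2 M"
  shows "f \<in> borel_measurable M" "integrable M (\<lambda>x. (cmod (f x))\<^sup>2)"
  using assms by (auto simp: L2_def)

lemma integrable_L2_mult:
  assumes "f \<in> L2 M" "g \<in> L2 M"
  shows "integrable M (\<lambda>x. f x * cnj (g x))"
proof (rule Bochner_Integration.integrable_bound)
  show "integrable M (\<lambda>x. (1 * (cmod (f x))\<^sup>2 + (cmod (g x))\<^sup>2 / 1) / 2)"
    using assms[THEN L2_D(2)] by simp
  have "f \<in> borel_measurable M" "g \<in> borel_measurable M"
    using assms[THEN L2_D(1)] by auto
  then show "(\<lambda>x. f x * cnj (g x)) \<in> borel_measurable M"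
    by (intro borel_measurable_times measurable_compose[OF _ borel_measurable_continuous_onI[OF continuous_on_cnj[OF continuous_on_id]]])
  show "AE x in M. norm (f x * cnj (g x)) \<le> norm ((1 * (cmod (f x))\<^sup>2 + (cmod (g x))\<^sup>2 / 1) / 2)"
    using norm_mult_le_weighted_mean[of 1] by (intro AE_I2) (smt (verit) real_norm_def)
qed

lemma L2_diff:
  assumes "f \<in> L2 M" "g \<in> L2 M"
  shows "(\<lambda>x. f x - g x) \<in> L2 M"
proof -
  have [measurable]: "f \<in> borel_measurable M" "g \<in> borel_measurable M"
    using assms[THEN L2_D(1)] by auto
  have "integrable M (\<lambda>x. (cmod (f x - g x))\<^sup>2)"
  proof (rule Bochner_Integration.integrable_bound)
    show "integrable M (\<lambda>x. 2 * (cmod (f x))\<^sup>2 + 2 * (cmod (g x))\<^sup>2)"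
      using assms[THEN L2_D(2)] by simp
    have "(cmod (f x - g x))\<^sup>2 \<le> 2 * (cmod (f x))\<^sup>2 + 2 * (cmod (g x))\<^sup>2" for x
    proof -
      have "(cmod (f x - g x))\<^sup>2 \<le> (cmod (f x) + cmod (g x))\<^sup>2"
        by (intro power_mono norm_triangle_ineq4) auto
      then show ?thesis using sum_squares_bound[of "cmod (f x)" "cmod (g x)"]
        by (simp add: power2_sum)
    qed
    then show "AE x in M. norm ((cmod (f x - g x))\<^sup>2)
        \<le> norm (2 * (cmod (f x))\<^sup>2 + 2 * (cmod (g x))\<^sup>2)"
      by auto
  qed measurable
  then show ?thesis by (simp add: L2_def)
qed

lemma L2_norm_nonneg [simp]: "L2_norm M f \<ge> 0"
  by (simp add: L2_norm_def)

lemma L2_norm_sq: "(L2_norm M f)\<^sup>2 = (LINT x|M. (cmod (f x))\<^sup>2)"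
  by (simp add: L2_norm_def)

lemma L2_inner_self: "L2_inner M f f = of_real ((L2_norm M f)\<^sup>2)"
  by (simp add: L2_inner_def L2_norm_sq complex_norm_square[symmetric] del: of_real_power)

lemma L2_inner_diff_left:
  assumes "f \<in> L2 M" "g \<in> L2 M" "h \<in> L2 M"
  shows "L2_inner M (\<lambda>x. f x - g x) h = L2_inner M f h - L2_inner M g h"
  using integrable_L2_mult[OF assms(1,3)] integrable_L2_mult[OF assms(2,3)]
  by (simp add: L2_inner_def left_diff_distrib)

lemma L2_inner_diff_right:
  assumes "f \<in> L2 M" "g \<in> L2 M" "h \<in> L2 M"
  shows "L2_inner M h (\<lambda>x. f x - g x) = L2_inner M h f - L2_inner M h g"
  using integrable_L2_mult[OF assms(3,1)] integrable_L2_mult[OF assms(3,2)]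
  by (simp add: L2_inner_def right_diff_distrib)

lemma L2_inner_commute: "L2_inner M g f = cnj (L2_inner M f g)"
proof -
  have "cnj (L2_inner M f g) = (LINT x|M. cnj (f x * cnj (g x)))"
    by (simp add: L2_inner_def del: complex_cnj_mult)
  then show ?thesis by (simp add: L2_inner_def mult.commute)
qed

lemma L2_Cauchy_Schwarz:
  assumes "f \<in> L2 M" "g \<in> L2 M"
  shows "cmod (L2_inner M f g) \<le> L2_norm M f * L2_norm M g"
proof (rule le_mult_if_le_weighted_mean)
  fix e :: real assume "e > 0"
  have int: "integrable M (\<lambda>x. (cmod (f x))\<^sup>2)" "integrable M (\<lambda>x. (cmod (g x))\<^sup>2)"
    using assms[THEN L2_D(2)] by auto
  have "cmod (L2_inner M f g) \<le> (LINT x|M. cmod (f x * cnj (g x)))"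
    unfolding L2_inner_def by (rule integral_norm_bound)
  also have "\<dots> \<le> (LINT x|M. (e * (cmod (f x))\<^sup>2 + (cmod (g x))\<^sup>2 / e) / 2)"
    using int integrable_L2_mult[OF assms] norm_mult_le_weighted_mean[OF \<open>e > 0\<close>]
    by (intro integral_mono) auto
  also have "\<dots> = (e * (L2_norm M f)\<^sup>2 + (L2_norm M g)\<^sup>2 / e) / 2"
    using int by (simp add: L2_norm_sq)
  finally show "cmod (L2_inner M f g) \<le> (e * (L2_norm M f)\<^sup>2 + (L2_norm M g)\<^sup>2 / e) / 2" .
qed auto

text \<open>Triangle inequality: pair u = f - (f - u) with u, apply Cauchy-Schwarz and cancel one
  factor \<open>L2_norm M u\<close>. This direction bounds the norm of an approximant f from
  below.\<close>

lemma L2_norm_le_add_diff: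
  assumes "f \<in> L2 M" "u \<in> L2 M"
  shows "L2_norm M u \<le> L2_norm M f + L2_norm M (\<lambda>x. f x - u x)"
proof (cases "L2_norm M u = 0")
  case False
  have d: "(\<lambda>x. f x - u x) \<in> L2 M" using assms by (rule L2_diff)
  have "(L2_norm M u)\<^sup>2 = cmod (L2_inner M u u)" by (simp add: L2_inner_self norm_power)
  also have "L2_inner M u u = L2_inner M f u - L2_inner M (\<lambda>x. f x - u x) u"
    using assms by (simp add: L2_inner_diff_left)
  also have "cmod \<dots> \<le> cmod (L2_inner M f u) + cmod (L2_inner M (\<lambda>x. f x - u x) u)"
    by (rule norm_triangle_ineq4)
  also have "\<dots> \<le> L2_norm M f * L2_norm M u + L2_norm M (\<lambda>x. f x - u x) * L2_norm M u"
    using assms d by (intro add_mono L2_Cauchy_Schwarz)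
  finally have "L2_norm M u * L2_norm M u
      \<le> (L2_norm M f + L2_norm M (\<lambda>x. f x - u x)) * L2_norm M u"
    by (simp add: power2_eq_square algebra_simps)
  moreover have "L2_norm M u > 0" using False L2_norm_nonneg[of M u] by linarith
  ultimately show ?thesis by simp
qed simp

lemma L2_norm_eq_0_iff:
  assumes "u \<in> L2 M"
  shows "L2_norm M u = 0 \<longleftrightarrow> (AE x in M. u x = 0)"
  using integral_nonneg_eq_0_iff_AE[OF L2_D(2)[OF assms]] by (simp add: L2_norm_def)

section \<open>Smooth functions\<close>

text \<open>A class of functions closed under differentiation yields the whole sequence of
  derivatives that \<open>smooth_on\<close> asks for, by iterating a choice \<open>d\<close> of
  derivative inside the class.\<close>

lemma smooth_onI:
  assumes "f \<in> F" and ex: "\<And>g. g \<in> F \<Longrightarrow> \<exists>g'\<in>F. \<forall>x\<in>S. (g has_vector_derivative g' x) (at x within S)"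
  shows "smooth_on S f"
proof -
  obtain d where d: "\<And>g. g \<in> F \<Longrightarrow> d g \<in> F"
    "\<And>g x. g \<in> F \<Longrightarrow> x \<in> S \<Longrightarrow> (g has_vector_derivative d g x) (at x within S)"
    using ex by metis
  have "(d ^^ k) f \<in> F" for k by (induction k) (auto simp: assms(1) d)
  then show ?thesis
    unfolding smooth_on_def by (intro exI[of _ "\<lambda>k. (d ^^ k) f"]) (auto simp: d)
qed

text \<open>By the sum and product rules it is enough to know that the derivatives of the generators
  stay in the generated algebra. This avoids formulas for higher derivatives of products.\<close>

inductive_set function_algebra ::
  "(real \<Rightarrow> 'a::real_normed_algebra) set \<Rightarrow> (real \<Rightarrow> 'a) set" for G
where
  base: "g \<in> G \<Longrightarrow> g \<in> function_algebra G"
| add: "f \<in> function_algebra G \<Longrightarrow> g \<in> function_algebra G \<Longrightarrow> (\<lambda>x. f x + g x) \<in> function_algebra G"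
| scale: "f \<in> function_algebra G \<Longrightarrow> (\<lambda>x. c *\<^sub>R f x) \<in> function_algebra G"
| mult: "f \<in> function_algebra G \<Longrightarrow> g \<in> function_algebra G \<Longrightarrow> (\<lambda>x. f x * g x) \<in> function_algebra G"

lemma smooth_on_function_algebra:
  assumes "f \<in> function_algebra G"
    and G: "\<And>g. g \<in> G \<Longrightarrow>
      \<exists>g'\<in>function_algebra G. \<forall>x\<in>S. (g has_vector_derivative g' x) (at x within S)"
  shows "smooth_on S f"
proof (rule smooth_onI[OF assms(1)])
  fix g assume "g \<in> function_algebra G"
  then show "\<exists>g'\<in>function_algebra G. \<forall>x\<in>S. (g has_vector_derivative g' x) (at x within S)"
  proof induction
    case (add f g)
    then obtain f' g' where "f' \<in> function_algebra G" "g' \<in> function_algebra G"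
      "\<forall>x\<in>S. (f has_vector_derivative f' x) (at x within S)"
      "\<forall>x\<in>S. (g has_vector_derivative g' x) (at x within S)" by blast
    then show ?case
      by (intro bexI[of _ "\<lambda>x. f' x + g' x"])
        (auto intro: function_algebra.add has_vector_derivative_add)
  next
    case (scale f c)
    then obtain f' where "f' \<in> function_algebra G"
      "\<forall>x\<in>S. (f has_vector_derivative f' x) (at x within S)" by blast
    then show ?case
      by (intro bexI[of _ "\<lambda>x. c *\<^sub>R f' x"])
        (auto intro: function_algebra.scale
          bounded_linear.has_vector_derivative[OF bounded_linear_scaleR_right])
  next
    case (mult f g)
    then obtain f' g' where "f' \<in> function_algebra G" "g' \<in> function_algebra G"
      "\<forall>x\<in>S. (f has_vector_derivative f' x) (at x within S)"
      "\<forall>x\<in>S. (g has_vector_derivative g' x) (at x within S)" by blast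
    then show ?case using mult.hyps
      by (intro bexI[of _ "\<lambda>x. f x * g' x + f' x * g x"])
        (auto intro: function_algebra.add function_algebra.mult has_vector_derivative_mult)
  qed (rule G)
qed

lemma smooth_on_mult:
  fixes f g :: "real \<Rightarrow> 'a::real_normed_algebra"
  assumes "smooth_on S f" "smooth_on S g"
  shows "smooth_on S (\<lambda>x. f x * g x)"
proof -
  obtain D E where D: "D 0 = f" "\<And>k x. x \<in> S \<Longrightarrow> (D k has_vector_derivative D (Suc k) x) (at x within S)"
    and E: "E 0 = g" "\<And>k x. x \<in> S \<Longrightarrow> (E k has_vector_derivative E (Suc k) x) (at x within S)"
    using assms unfolding smooth_on_def by metis
  show ?thesis
  proof (rule smooth_on_function_algebra[where G = "range D \<union> range E"])
    show "(\<lambda>x. f x * g x) \<in> function_algebra (range D \<union> range E)"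
      using D(1) E(1) by (intro function_algebra.mult function_algebra.base) auto
    fix h assume "h \<in> range D \<union> range E"
    then show "\<exists>h'\<in>function_algebra (range D \<union> range E).
        \<forall>x\<in>S. (h has_vector_derivative h' x) (at x within S)"
      using D(2) E(2) by (blast intro: function_algebra.base)
  qed
qed

lemma smooth_on_diff:
  assumes "smooth_on S f" "smooth_on S g"
  shows "smooth_on S (\<lambda>x. f x - g x)"
proof -
  obtain D E where D: "D 0 = f" "\<And>k x. x \<in> S \<Longrightarrow> (D k has_vector_derivative D (Suc k) x) (at x within S)"
    and E: "E 0 = g" "\<And>k x. x \<in> S \<Longrightarrow> (E k has_vector_derivative E (Suc k) x) (at x within S)"
    using assms unfolding smooth_on_def by metis
  then show ?thesis unfolding smooth_on_def
    by (intro exI[of _ "\<lambda>k x. D k x - E k x"]) (auto intro: has_vector_derivative_diff)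
qed

lemma smooth_on_of_real:
  assumes "smooth_on S f"
  shows "smooth_on S (\<lambda>x. of_real (f x) :: complex)"
proof -
  obtain D where D: "D 0 = f" "\<And>k x. x \<in> S \<Longrightarrow> (D k has_vector_derivative D (Suc k) x) (at x within S)"
    using assms unfolding smooth_on_def by metis
  then show ?thesis unfolding smooth_on_def
    by (intro exI[of _ "\<lambda>k x. of_real (D k x)"])
      (auto intro: bounded_linear.has_vector_derivative[OF bounded_linear_of_real])
qed

lemma smooth_on_affine:
  assumes "smooth_on UNIV f"
  shows "smooth_on S (\<lambda>x. f (a * x + b))"
proof -
  obtain D where D: "D 0 = f" "\<And>k x. (D k has_vector_derivative D (Suc k) x) (at x)"
    using assms unfolding smooth_on_def by auto
  have "((\<lambda>x. a ^ k *\<^sub>R D k (a * x + b)) has_vector_derivative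
      a ^ Suc k *\<^sub>R D (Suc k) (a * x + b)) (at x within S)" for k x
  proof -
    have "((\<lambda>x. a * x + b) has_vector_derivative a) (at x within S)"
      by (auto intro!: derivative_eq_intros simp: has_real_derivative_iff_has_vector_derivative[symmetric])
    from vector_diff_chain_within[OF this has_vector_derivative_at_within[OF D(2)]]
    have "(D k \<circ> (\<lambda>x. a * x + b) has_vector_derivative a *\<^sub>R D (Suc k) (a * x + b)) (at x within S)" .
    from bounded_linear.has_vector_derivative[OF bounded_linear_scaleR_right this, of "a ^ k"]
    show ?thesis by (simp add: o_def mult.commute)
  qed
  then show ?thesis unfolding smooth_on_def
    by (intro exI[of _ "\<lambda>k x. a ^ k *\<^sub>R D k (a * x + b)"]) (auto simp: D(1))
qed

lemma smooth_on_cis: "smooth_on S (\<lambda>x. cis (k * x))"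
\<comment> \<open>The constants are generators because the derivative brings down the complex factor
  \<open>\<i> * k\<close>, which \<open>scale\<close> (real scalars) does not provide.\<close>
proof (rule smooth_on_function_algebra[where G = "range (\<lambda>c x. c) \<union> {\<lambda>x. cis (k * x)}"])
  let ?G = "range (\<lambda>c x. c) \<union> {\<lambda>x. cis (k * x)}"
  show "(\<lambda>x. cis (k * x)) \<in> function_algebra ?G" by (intro function_algebra.base) auto
  have *: "((\<lambda>x. cis (k * x)) has_vector_derivative (\<i> * k) * cis (k * x)) (at x within S)" for x
    by (auto intro!: derivative_eq_intros simp: has_vector_derivative_def scaleR_conv_of_real)
  have "(\<lambda>x. (\<i> * k) * cis (k * x)) \<in> function_algebra ?G"
    by (intro function_algebra.mult function_algebra.base) auto
  moreover have "(\<lambda>x. 0) \<in> function_algebra ?G" by (intro function_algebra.base) auto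
  ultimately show "\<exists>g'\<in>function_algebra ?G. \<forall>x\<in>S. (g has_vector_derivative g' x) (at x within S)"
    if "g \<in> ?G" for g
    using that
  proof (elim UnE)
    assume "g \<in> range (\<lambda>c x. c)"
    then show ?thesis using \<open>(\<lambda>x. 0) \<in> function_algebra ?G\<close>
      by (intro bexI[of _ "\<lambda>x. 0"]) auto
  next
    assume "g \<in> {\<lambda>x. cis (k * x)}"
    then show ?thesis using \<open>(\<lambda>x. (\<i> * k) * cis (k * x)) \<in> function_algebra ?G\<close> *
      by (intro bexI[of _ "\<lambda>x. (\<i> * k) * cis (k * x)"]) auto
  qed
qed

section \<open>A smooth bump function with support in [0, 1]\<close>

definition exp_quotient :: "nat \<Rightarrow> real \<Rightarrow> real" where
  "exp_quotient k x = (if x \<le> 0 then 0 else exp (- (1 / x)) / x ^ k)"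

text \<open>The power of x in the denominator is carried as an index so that the family is closed
  under differentiation up to linear combinations, also at 0, where exp(-1/x) beats every
  power.\<close>

lemma exp_quotient_has_derivative:
  "(exp_quotient k has_vector_derivative
     exp_quotient (k + 2) x - real k * exp_quotient (k + 1) x) (at x)"
proof (cases "x = 0")
  case True
  have "((\<lambda>h. exp_quotient k h / h) \<longlongrightarrow> 0) (at 0)"
  proof (rule filterlim_split_at)
    show "((\<lambda>h. exp_quotient k h / h) \<longlongrightarrow> 0) (at_left 0)"
      by (rule tendsto_eventually) (auto simp: exp_quotient_def eventually_at_left_field intro!: exI[of _ "-1"])
    \<comment> \<open>For h > 0 and y = 1/h, the difference quotient at 0 is y^(k+1) / exp
      y.\<close>
    have "((\<lambda>y::real. y ^ (k + 1) / exp y) \<longlongrightarrow> 0) at_top"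
      by (rule tendsto_power_div_exp_0)
    then have "((\<lambda>h::real. (inverse h) ^ (k + 1) / exp (inverse h)) \<longlongrightarrow> 0) (at_right 0)"
      by (rule filterlim_compose[OF _ filterlim_inverse_at_top_right])
    moreover have "\<forall>\<^sub>F h in at_right 0. (inverse h) ^ (k + 1) / exp (inverse h) = exp_quotient k h / h"
      by (rule eventually_mono[OF eventually_at_right_less[of 0]])
        (auto simp: exp_quotient_def field_simps exp_minus power_inverse)
    ultimately show "((\<lambda>h. exp_quotient k h / h) \<longlongrightarrow> 0) (at_right 0)"
      by (rule Lim_transform_eventually)
  qed
  then have "(exp_quotient k has_real_derivative 0) (at 0)"
    by (simp add: DERIV_def exp_quotient_def)
  then show ?thesis using True
    by (simp add: exp_quotient_def has_real_derivative_iff_has_vector_derivative)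
next
  case False
  show ?thesis
  proof (cases "x < 0")
    case True
    have "((\<lambda>x. 0::real) has_vector_derivative 0) (at x)" by simp
    then have "(exp_quotient k has_vector_derivative 0) (at x)"
      by (rule has_vector_derivative_transform_within_open[of _ _ _ "{..<0}"])
        (use True in \<open>auto simp: exp_quotient_def\<close>)
    then show ?thesis using True by (simp add: exp_quotient_def)
  next
    case xpos: False
    have "((\<lambda>x. exp (- (1 / x)) / x ^ k) has_real_derivative
        exp (- (1 / x)) / x ^ (k + 2) - real k * (exp (- (1 / x)) / x ^ (k + 1))) (at x)"
    proof (cases k)
      case 0
      then show ?thesis using False xpos
        by (auto intro!: derivative_eq_intros simp: field_simps power2_eq_square)
    next
      case (Suc j)
      then show ?thesis using False xpos
        by (auto intro!: derivative_eq_intros simp: field_simps power2_eq_square)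
          (metis One_nat_def power_eq_if)
    qed
    then have "((\<lambda>x. exp (- (1 / x)) / x ^ k) has_vector_derivative
        exp (- (1 / x)) / x ^ (k + 2) - real k * (exp (- (1 / x)) / x ^ (k + 1))) (at x)"
      by (simp add: has_real_derivative_iff_has_vector_derivative)
    then have "(exp_quotient k has_vector_derivative
        exp (- (1 / x)) / x ^ (k + 2) - real k * (exp (- (1 / x)) / x ^ (k + 1))) (at x)"
      by (rule has_vector_derivative_transform_within_open[of _ _ _ "{0<..}"])
        (use False xpos in \<open>auto simp: exp_quotient_def\<close>)
    then show ?thesis using False xpos by (simp add: exp_quotient_def)
  qed
qed

lemma smooth_on_exp_quotient: "smooth_on S (exp_quotient k)"
proof (rule smooth_on_function_algebra[where G = "range exp_quotient"])
  show "exp_quotient k \<in> function_algebra (range exp_quotient)"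
    by (intro function_algebra.base) auto
  fix g assume "g \<in> range exp_quotient"
  then obtain j where g: "g = exp_quotient j" by auto
  have "(\<lambda>x. exp_quotient (j + 2) x + (- real j) *\<^sub>R exp_quotient (j + 1) x)
      \<in> function_algebra (range exp_quotient)"
    by (intro function_algebra.add function_algebra.scale function_algebra.base) auto
  moreover have "\<forall>x\<in>S. (g has_vector_derivative
      exp_quotient (j + 2) x + (- real j) *\<^sub>R exp_quotient (j + 1) x) (at x within S)"
    using exp_quotient_has_derivative[of j]
    by (auto simp: g intro: has_vector_derivative_at_within)
  ultimately show "\<exists>g'\<in>function_algebra (range exp_quotient).
      \<forall>x\<in>S. (g has_vector_derivative g' x) (at x within S)"
    by (intro bexI[of _ "\<lambda>x. exp_quotient (j + 2) x + (- real j) *\<^sub>R exp_quotient (j + 1) x"])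
qed

definition bump :: "real \<Rightarrow> real" where
  "bump x = exp_quotient 0 x * exp_quotient 0 (1 - x)"

lemma smooth_on_bump: "smooth_on S bump"
proof -
  have "smooth_on S (\<lambda>x. exp_quotient 0 ((-1) * x + 1))"
    by (intro smooth_on_affine smooth_on_exp_quotient)
  then have "smooth_on S (\<lambda>x. exp_quotient 0 x * exp_quotient 0 (1 - x))"
    by (intro smooth_on_mult smooth_on_exp_quotient) (simp add: add.commute)
  then show ?thesis by (simp add: bump_def[abs_def])
qed

lemma bump_eq_0: "x \<notin> {0..1} \<Longrightarrow> bump x = 0"
  by (auto simp: bump_def exp_quotient_def)

text \<open>Both reciprocals in the exponents are at most 3 on the middle third. The fixed lower
  bound there keeps the norm of a wave packet comparable to its width.\<close>

lemma bump_ge: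
  assumes "x \<in> {1/3..2/3}"
  shows "bump x \<ge> exp (- 6)"
proof -
  have "1 / x \<le> 3" "1 / (1 - x) \<le> 3" using assms by (auto simp: field_simps)
  then have "exp (-6) \<le> exp (- (1 / x) + - (1 / (1 - x)))" by simp
  also have "\<dots> = bump x" using assms by (auto simp: bump_def exp_quotient_def exp_add[symmetric])
  finally show ?thesis .
qed

section \<open>A lower bound for the vortex profile\<close>

lemma vortex_profileE:
  assumes "vortex_profile U"
  obtains U' U'' where
    "\<And>r. r \<ge> 0 \<Longrightarrow> (U has_real_derivative U' r) (at r within {0..})"
    "\<And>r. r \<ge> 0 \<Longrightarrow> (U' has_real_derivative U'' r) (at r within {0..})"
    "\<And>r. r > 0 \<Longrightarrow> U'' r + 1 / r * U' r - 1 / r\<^sup>2 * U r + (1 - (U r)\<^sup>2) * U r = 0"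
    "\<And>r. r \<ge> 0 \<Longrightarrow> U' r > 0" "U 0 = 0" "(U \<longlongrightarrow> 1) at_top"
  using assms unfolding vortex_profile_def by blast

text \<open>At a maximum \<open>m \<ge> 0\<close> of \<open>V / U\<close> with value above \<open>1\<close> (where at \<open>0\<close> the quotient is
  \<open>V'(0) / U'(0)\<close>) the weighted Wronskian \<open>r (V' U - V U')\<close> vanishes, and the differential
  inequality makes it increase to the right of \<open>m\<close>, so \<open>V / U\<close> increases there as well.\<close>

lemma subsolution_le_vortex_profile:
  fixes U V V' V'' \<rho> :: "real \<Rightarrow> real"
  assumes U: "vortex_profile U"
    and V: "\<And>r. r > 0 \<Longrightarrow> (V has_real_derivative V' r) (at r)"
    and V': "\<And>r. r > 0 \<Longrightarrow> (V' has_real_derivative V'' r) (at r)"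
    and sub: "\<And>r. r > 0 \<Longrightarrow> V'' r + 1 / r * V' r - 1 / r\<^sup>2 * V r + (1 - (V r)\<^sup>2) * V r \<ge> 0"
    and pos: "\<And>r. r > 0 \<Longrightarrow> V r > 0"
    and V_eq: "\<And>r. r > 0 \<Longrightarrow> V r = r * \<rho> r" and \<rho>: "continuous_on {0..} \<rho>"
    and V'0: "((\<lambda>r. r * V' r) \<longlongrightarrow> 0) (at_right 0)"
    and lim: "(V \<longlongrightarrow> 1) at_top"
    and "p > 0"
  shows "V p \<le> U p"
proof (rule ccontr)
  assume "\<not> V p \<le> U p"
  obtain U' U'' where
    dU: "\<And>r. r \<ge> 0 \<Longrightarrow> (U has_real_derivative U' r) (at r within {0..})" and
    dU': "\<And>r. r \<ge> 0 \<Longrightarrow> (U' has_real_derivative U'' r) (at r within {0..})" and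
    ode: "\<And>r. r > 0 \<Longrightarrow> U'' r + 1 / r * U' r - 1 / r\<^sup>2 * U r + (1 - (U r)\<^sup>2) * U r = 0" and
    U'pos: "\<And>r. r \<ge> 0 \<Longrightarrow> U' r > 0" and U0: "U 0 = 0" and limU: "(U \<longlongrightarrow> 1) at_top"
    using vortex_profileE[OF U] by blast
  have at_within: "at r within {0..} = at r" if "r > 0" for r :: real
    using that by (intro at_within_interior) auto
  have at_0: "at 0 within {0..} = at_right (0::real)"
    by (auto simp: at_within_def intro!: arg_cong2[of _ _ _ _ inf] arg_cong[of _ _ principal])
  have dU1: "(U has_real_derivative U' r) (at r)" and dU2: "(U' has_real_derivative U'' r) (at r)"
    if "r > 0" for r using dU[of r] dU'[of r] that by (auto simp: at_within)
  have contU: "continuous_on {0..} U" and contU': "continuous_on {0..} U'"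
    using dU dU' by (auto intro!: DERIV_continuous_on)
  have Upos: "U r > 0" if "r > 0" for r
  proof -
    have "U 0 < U r"
    proof (rule DERIV_pos_imp_increasing_open[OF that])
      show "continuous_on {0..r} U" using contU by (rule continuous_on_subset) auto
    qed (use dU1 U'pos in \<open>auto intro!: exI\<close>)
    then show ?thesis using U0 by simp
  qed
  \<comment> \<open>This is V / U with numerator and denominator divided by r. The denominator U r /
    r extends continuously to 0 by U' 0 > 0, so the maximum may be sought on a closed interval
    starting at 0.\<close>
  define q where "q r = \<rho> r / (if r = 0 then U' 0 else U r / r)" for r
  define W where "W r = r * (V' r * U r - V r * U' r)" for r
  have q_eq: "q r = V r / U r" if "r > 0" for r
    using that V_eq[of r] by (simp add: q_def)
  have contq: "continuous_on {0..} q"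
    unfolding q_def
  proof (intro continuous_on_divide \<rho>)
    show "continuous_on {0..} (\<lambda>r. if r = 0 then U' 0 else U r / r)"
      unfolding continuous_on_def
    proof
      fix r :: real assume "r \<in> {0..}"
      show "((\<lambda>r. if r = 0 then U' 0 else U r / r) \<longlongrightarrow> (if r = 0 then U' 0 else U r / r))
          (at r within {0..})"
      proof (cases "r = 0")
        case True
        have "((\<lambda>r. U r / r) \<longlongrightarrow> U' 0) (at 0 within {0..})"
          using dU[of 0] by (simp add: has_field_derivative_iff U0)
        then show ?thesis unfolding True
          by (auto elim!: Lim_transform_eventually simp: eventually_at_filter)
      next
        case False
        then have "r > 0" using \<open>r \<in> {0..}\<close> by simp
        then have "((\<lambda>r. U r / r) \<longlongrightarrow> U r / r) (at r)"
          using DERIV_isCont[OF dU1[of r]] by (auto intro!: tendsto_intros simp: isCont_def)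
        moreover have "\<forall>\<^sub>F x in at r. U x / x = (if x = 0 then U' 0 else U x / x)"
          by (rule eventually_mono[OF eventually_at_in_open'[of "{0<..}" r]]) (use \<open>r > 0\<close> in auto)
        ultimately show ?thesis using False \<open>r > 0\<close>
          by (auto simp: at_within elim: Lim_transform_eventually)
      qed
    qed
  next
    show "\<forall>x\<in>{0..}. (if x = 0 then U' 0 else U x / x) \<noteq> 0"
      using Upos U'pos[of 0] by (auto simp: order_less_le)
  qed
  have q_der: "(q has_real_derivative W r / (r * (U r)\<^sup>2)) (at r)" if "r > 0" for r
  proof -
    have "((\<lambda>r. V r / U r) has_real_derivative W r / (r * (U r)\<^sup>2)) (at r)"
      using that Upos[OF that]
      by (auto intro!: derivative_eq_intros V dU1 simp: W_def field_simps power2_eq_square)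
    then show ?thesis
      by (rule has_field_derivative_transform_within_open[of _ _ _ "{0<..}"])
        (use that q_eq in auto)
  qed
  \<comment> \<open>Eliminating U'' by the vortex equation leaves r U times the residual of V,
    nonnegative by \<open>sub\<close>, and a cubic remainder that is positive wherever V >
    U.\<close>
  have W_der: "(W has_real_derivative r * (V'' r + 1 / r * V' r - 1 / r\<^sup>2 * V r + (1 - (V r)\<^sup>2) * V r) * U r
      + r * (U r * V r * ((V r)\<^sup>2 - (U r)\<^sup>2))) (at r)" if "r > 0" for r
  proof -
    have U'': "U'' r = - (1 / r * U' r - 1 / r\<^sup>2 * U r + (1 - (U r)\<^sup>2) * U r)"
      using ode[OF that] by simp
    show ?thesis unfolding W_def
      using that
      by (auto intro!: derivative_eq_intros V V' dU1 dU2 simp: U'')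
        (simp add: field_simps power2_eq_square)
  qed
  \<comment> \<open>V' need not have a limit at 0; the factor r in W together with
    \<open>V'0\<close> makes W tend to 0, which is also W 0. This covers a maximum attained at m =
    0.\<close>
  have contW: "continuous_on {0..} W"
    unfolding continuous_on_def
  proof
    fix r :: real assume "r \<in> {0..}"
    show "(W \<longlongrightarrow> W r) (at r within {0..})"
    proof (cases "r = 0")
      case True
      have lims: "(U \<longlongrightarrow> 0) (at_right 0)" "(U' \<longlongrightarrow> U' 0) (at_right 0)" "(\<rho> \<longlongrightarrow> \<rho> 0) (at_right 0)"
        using contU contU' \<rho> U0 unfolding continuous_on_def at_0[symmetric]
        by (metis atLeast_iff order_refl)+
      have "((\<lambda>r. (r * V' r) * U r - r * (r * \<rho> r) * U' r) \<longlongrightarrow> 0 * 0 - 0 * (0 * \<rho> 0) * U' 0) (at_right 0)"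
        by (intro tendsto_intros lims V'0)
      moreover have "\<forall>\<^sub>F r in at_right 0. (r * V' r) * U r - r * (r * \<rho> r) * U' r = W r"
        by (rule eventually_mono[OF eventually_at_right_less[of 0]])
          (auto simp: W_def V_eq algebra_simps)
      ultimately have "(W \<longlongrightarrow> 0) (at_right 0)"
        using Lim_transform_eventually by fastforce
      then show ?thesis by (simp add: True at_0 W_def)
    next
      case False
      then have "r > 0" using \<open>r \<in> {0..}\<close> by simp
      then show ?thesis using DERIV_isCont[OF W_der] by (simp add: at_within isCont_def)
    qed
  qed
  have "q p > 1" using \<open>\<not> V p \<le> U p\<close> q_eq[OF \<open>p > 0\<close>] Upos[OF \<open>p > 0\<close>] by simp
  have "((\<lambda>r. V r / U r) \<longlongrightarrow> 1 / 1) at_top" by (intro tendsto_intros lim limU) simp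
  then have "\<forall>\<^sub>F r in at_top. V r / U r < q p" using \<open>q p > 1\<close> by (simp add: order_tendstoD)
  then obtain R where R: "\<And>r. r \<ge> R \<Longrightarrow> V r / U r < q p" by (auto simp: eventually_at_top_linorder)
  \<comment> \<open>Beyond R the quotient stays below q p, so a maximum over [0, R'] is a maximum
    over the whole half-line; R' >= p puts p into the interval.\<close>
  define R' where "R' = max R p"
  obtain m where m: "m \<in> {0..R'}" "\<And>r. r \<in> {0..R'} \<Longrightarrow> q r \<le> q m"
    using continuous_attains_sup[of "{0..R'}" q] continuous_on_subset[OF contq, of "{0..R'}"] \<open>p > 0\<close>
    unfolding R'_def by fastforce
  have "p \<in> {0..R'}" using \<open>p > 0\<close> by (auto simp: R'_def)
  then have qm: "q m > 1" using m(2)[of p] \<open>q p > 1\<close> by simp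
  have max: "q r \<le> q m" if "r \<ge> 0" for r
  proof (cases "r \<le> R'")
    case False
    then have "q r < q p" using R[of r] q_eq[of r] \<open>p > 0\<close> by (auto simp: R'_def)
    then show ?thesis using m(2)[of p] \<open>p \<in> {0..R'}\<close> by simp
  qed (use m(2) that in auto)
  have "W m = 0"
  proof (cases "m = 0")
    case False
    then have "m > 0" using m by simp
    then have "W m / (m * (U m)\<^sup>2) = 0"
      using max by (intro DERIV_local_max[OF q_der[OF \<open>m > 0\<close>], of m]) auto
    then show ?thesis using \<open>m > 0\<close> Upos[OF \<open>m > 0\<close>] by simp
  qed (simp add: W_def)
  have "(q \<longlongrightarrow> q m) (at m within {0..})"
    using contq m by (auto simp: continuous_on_def)
  then have "\<forall>\<^sub>F r in at m within {0..}. q r > 1" using qm by (rule order_tendstoD)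
  then obtain d where d: "d > 0" "\<And>r. r \<ge> 0 \<Longrightarrow> r \<noteq> m \<Longrightarrow> dist r m < d \<Longrightarrow> q r > 1"
    by (auto simp: eventually_at)
  define n where "n = m + d / 2"
  have mn: "m < n" "m \<ge> 0" using d m by (auto simp: n_def)
  have q1: "V r > U r" if "m < r" "r \<le> n" for r
    using d(2)[of r] that mn d(1) q_eq[of r] Upos[of r] by (auto simp: n_def dist_real_def)
  have Wpos: "W r > 0" if "m < r" "r \<le> n" for r
  proof -
    have "W m < W r"
    proof (rule DERIV_pos_imp_increasing_open[OF \<open>m < r\<close>])
      show "continuous_on {m..r} W" using contW by (rule continuous_on_subset) (use mn in auto)
      fix x assume x: "m < x" "x < r"
      then have "x > 0" "V x > U x" using mn q1[of x] that by auto
      then have "(V x)\<^sup>2 > (U x)\<^sup>2" using Upos[of x] by (intro power_strict_mono) auto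
      then show "\<exists>y. (W has_real_derivative y) (at x) \<and> y > 0"
        using \<open>x > 0\<close> Upos[of x] pos[of x] sub[of x]
        by - (rule exI, rule conjI, rule W_der, auto intro!: add_nonneg_pos mult_nonneg_nonneg)
    qed
    then show ?thesis using \<open>W m = 0\<close> by simp
  qed
  have "q m < q n"
  proof (rule DERIV_pos_imp_increasing_open[OF \<open>m < n\<close>])
    show "continuous_on {m..n} q" using contq by (rule continuous_on_subset) (use mn in auto)
    fix x assume x: "m < x" "x < n"
    then have "x > 0" using mn by simp
    then show "\<exists>y. (q has_real_derivative y) (at x) \<and> y > 0"
      using Wpos[of x] x Upos[of x] by - (rule exI, rule conjI, rule q_der, auto)
  qed
  then show False using max[of n] mn by simp
qed

text \<open>The numerator that decides the sign of the residual of the subsolution below, with t =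
  r^2. The summand with (t - 3)^2 absorbs the cubic and linear terms; what is left is a quadratic in
  t^2, completed to a square, and a positive constant.\<close>

lemma quartic_pos:
  fixes t :: real
  assumes "t \<ge> 0"
  shows "10 * t^4 + 58 * t^3 - 167 * t\<^sup>2 - 681 * t + 2508 > 0"
proof -
  have "10 * t^4 + 58 * t^3 - 167 * t\<^sup>2 - 681 * t + 2508
      = (t - 3)\<^sup>2 * (58 * t + 401/2) + 10 * (t\<^sup>2 - 39/40)\<^sup>2 + (2508 - 3609/2 - 1521/160)"
    by (simp add: power2_eq_square power4_eq_xxxx power3_eq_cube field_simps)
  also have "\<dots> > 0" using assms by (intro add_nonneg_pos add_nonneg_nonneg mult_nonneg_nonneg) auto
  finally show ?thesis .
qed

text \<open>A subsolution \<open>V\<close> with \<open>V\<^sup>2 = t (t + 6) / (t\<^sup>2 + 7 t + 19)\<close>, \<open>t = r\<^sup>2\<close>. It matches the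
  behaviour \<open>V\<^sup>2 = 1 - 1 / r\<^sup>2 + O(r\<^sup>-\<^sup>4)\<close> of the vortex at infinity and has
  \<open>V'(0)\<^sup>2 = 6/19\<close>, slightly below \<open>U'(0)\<^sup>2 \<approx> 0.340\<close>. Here \<open>V' = G V\<close> with \<open>G = 1 / r + r a(r)\<close>.\<close>

lemma vortex_profile_sq_ge:
  assumes "vortex_profile U" "r > 0"
  shows "(U r)\<^sup>2 \<ge> r\<^sup>2 * (r\<^sup>2 + 6) / (r^4 + 7 * r\<^sup>2 + 19)"
proof -
  define N where "N r = r\<^sup>2 + 6" for r :: real
  define D where "D r = r^4 + 7 * r\<^sup>2 + 19" for r :: real
  define \<rho> where "\<rho> r = sqrt (N r / D r)" for r
  define V where "V r = r * \<rho> r" for r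
  \<comment> \<open>Half the logarithmic derivative of N / D, divided by r; hence the derivative of
    \<open>\<rho>\<close> is r a times \<open>\<rho>\<close>.\<close>
  define a where "a r = 1 / N r - (2 * r\<^sup>2 + 7) / D r" for r
  define a' where "a' r = - (2 * r) / (N r)\<^sup>2 - (4 * r * D r - (2 * r\<^sup>2 + 7) * (4 * r^3 + 14 * r)) / (D r)\<^sup>2" for r
  define V' where "V' r = (1 / r + r * a r) * V r" for r
  \<comment> \<open>From V' = G V it follows that V'' = (G' + G^2) V.\<close>
  define V'' where "V'' r = (- 1 / r\<^sup>2 + a r + r * a' r + (1 / r + r * a r)\<^sup>2) * V r" for r
  have NDpos: "N r > 0" "D r > 0" for r
  proof -
    have "r^4 \<ge> 0" "r\<^sup>2 \<ge> 0" by auto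
    then show "N r > 0" "D r > 0" unfolding N_def D_def by linarith+
  qed
  then have NDne: "N r \<noteq> 0" "D r \<noteq> 0" for r by (auto simp: order_less_le)
  have dN: "(N has_real_derivative 2 * r) (at r)" for r
    unfolding N_def by (auto intro!: derivative_eq_intros)
  have dD: "(D has_real_derivative 4 * r^3 + 14 * r) (at r)" for r
    unfolding D_def by (auto intro!: derivative_eq_intros)
  have \<rho>_pos: "\<rho> r > 0" for r using NDpos[of r] by (simp add: \<rho>_def)
  have \<rho>_sq: "(\<rho> r)\<^sup>2 = N r / D r" for r using NDpos[of r] by (simp add: \<rho>_def)
  have d\<rho>: "(\<rho> has_real_derivative r * a r * \<rho> r) (at r)" for r
  proof -
    have "((\<lambda>r. N r / D r) has_real_derivative
        (2 * r * D r - N r * (4 * r^3 + 14 * r)) / (D r * D r)) (at r)"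
      using NDne[of r] by (intro DERIV_divide dN dD)
    then have "(\<rho> has_real_derivative inverse (sqrt (N r / D r)) / 2 *
        ((2 * r * D r - N r * (4 * r^3 + 14 * r)) / (D r * D r))) (at r)"
      unfolding \<rho>_def using NDpos[of r]
      by (intro DERIV_chain2[OF DERIV_real_sqrt]) auto
    moreover have "inverse (sqrt (N r / D r)) / 2 *
        ((2 * r * D r - N r * (4 * r^3 + 14 * r)) / (D r * D r)) = r * a r * \<rho> r"
    proof -
      have "r * a r * \<rho> r = inverse (\<rho> r) * (r * a r * (\<rho> r)\<^sup>2)"
        using \<rho>_pos[of r] by (simp add: field_simps power2_eq_square)
      also have "r * a r * (\<rho> r)\<^sup>2 = (2 * r * D r - N r * (4 * r^3 + 14 * r)) / (D r * D r) / 2"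
        using NDne[of r] unfolding \<rho>_sq a_def
        by (simp add: divide_simps) (simp add: algebra_simps power2_eq_square power3_eq_cube)
      finally show ?thesis by (simp add: \<rho>_def)
    qed
    ultimately show ?thesis by simp
  qed
  have da: "(a has_real_derivative a' r) (at r)" for r
    unfolding a_def a'_def using NDne[of r]
    by (auto intro!: derivative_eq_intros dN dD simp: power2_eq_square)
  have dV: "(V has_real_derivative V' r) (at r)" if "r > 0" for r
    unfolding V_def V'_def using that
    by (auto intro!: derivative_eq_intros d\<rho> simp: field_simps)
  have dV': "(V' has_real_derivative V'' r) (at r)" if "r > 0" for r
  proof -
    have "((\<lambda>r. (1 / r + r * a r) * V r) has_real_derivative
        (- 1 / r\<^sup>2 + (a r + r * a' r)) * V r + V' r * (1 / r + r * a r)) (at r)"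
      using that
      by (intro DERIV_mult' DERIV_mult dV, auto intro!: derivative_eq_intros da dV simp: power2_eq_square)
    then show ?thesis unfolding V'_def[abs_def, symmetric]
      by (rule back_subst[where P = "\<lambda>d. (_ has_real_derivative d) _"])
        (simp add: V''_def V'_def power2_eq_square algebra_simps)
  qed
  have V_pos: "V r > 0" if "r > 0" for r using that \<rho>_pos[of r] by (simp add: V_def)
  have V_sq: "(V r)\<^sup>2 = r\<^sup>2 * N r / D r" for r by (simp add: V_def power_mult_distrib \<rho>_sq)
  have sub: "V'' r + 1 / r * V' r - 1 / r\<^sup>2 * V r + (1 - (V r)\<^sup>2) * V r \<ge> 0" if "r > 0" for r
  proof -
    define t where "t = r\<^sup>2"
    have ND: "N r = t + 6" "D r = t\<^sup>2 + 7 * t + 19" by (auto simp: N_def D_def t_def power_mult[symmetric])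
    have t0: "t \<ge> 0" by (simp add: t_def)
    have ND0: "t + 6 > 0" "t\<^sup>2 + 7 * t + 19 > 0" using NDpos[of r] by (auto simp: ND)
    \<comment> \<open>After V is factored out all terms in 1/r^2 cancel, and the remaining factor is
      a rational function of t alone.\<close>
    have "V'' r + 1 / r * V' r - 1 / r\<^sup>2 * V r + (1 - (V r)\<^sup>2) * V r
        = (4 * a r + r * a' r + r\<^sup>2 * (a r)\<^sup>2 + 1 - (V r)\<^sup>2) * V r"
      using that by (simp add: V''_def V'_def power2_eq_square field_simps)
    also have "4 * a r + r * a' r + r\<^sup>2 * (a r)\<^sup>2 + 1 - (V r)\<^sup>2
       = (10 * t^4 + 58 * t^3 - 167 * t\<^sup>2 - 681 * t + 2508) / ((t + 6)\<^sup>2 * (t\<^sup>2 + 7 * t + 19)\<^sup>2)"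
    proof -
      have ra: "r * a' r = - (2 * t) / (t + 6)\<^sup>2
          - (4 * t * (t\<^sup>2 + 7 * t + 19) - (2 * t + 7) * (4 * t\<^sup>2 + 14 * t)) / (t\<^sup>2 + 7 * t + 19)\<^sup>2"
        unfolding a'_def ND t_def[symmetric]
        by (simp add: t_def power2_eq_square power3_eq_cube right_diff_distrib distrib_left mult_ac)
      show ?thesis
        unfolding ra V_sq a_def ND t_def[symmetric] using ND0
        by (simp add: divide_simps) (simp add: algebra_simps power2_eq_square power3_eq_cube power4_eq_xxxx)
    qed
    also have "\<dots> * V r \<ge> 0"
      using quartic_pos[OF t0] V_pos[OF that] by simp
    finally show ?thesis .
  qed
  have cont: "isCont \<rho> r" "isCont a r" for r
    using DERIV_isCont[OF d\<rho>] DERIV_isCont[OF da] by auto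
  have V'0: "((\<lambda>r. r * V' r) \<longlongrightarrow> 0) (at_right 0)"
  proof -
    have "isCont (\<lambda>r. (1 + r\<^sup>2 * a r) * (r * \<rho> r)) 0" by (intro continuous_intros cont)
    then have "((\<lambda>r. (1 + r\<^sup>2 * a r) * (r * \<rho> r)) \<longlongrightarrow> 0) (at_right 0)"
      by (auto simp: isCont_def intro: tendsto_within_subset)
    moreover have "\<forall>\<^sub>F r in at_right 0. (1 + r\<^sup>2 * a r) * (r * \<rho> r) = r * V' r"
      by (rule eventually_mono[OF eventually_at_right_less[of 0]])
        (auto simp: V'_def V_def field_simps power2_eq_square)
    ultimately show ?thesis by (rule Lim_transform_eventually)
  qed
  have lim: "(V \<longlongrightarrow> 1) at_top"
  proof -
    have "((\<lambda>r::real. sqrt (r\<^sup>2 * (r\<^sup>2 + 6) / (r^4 + 7 * r\<^sup>2 + 19))) \<longlongrightarrow> sqrt 1) at_top"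
      by (intro tendsto_real_sqrt) real_asymp
    moreover have "\<forall>\<^sub>F r in at_top. sqrt (r\<^sup>2 * (r\<^sup>2 + 6) / (r^4 + 7 * r\<^sup>2 + 19)) = V r"
    proof (rule eventually_mono[OF eventually_gt_at_top[of 0]])
      fix r :: real assume "r > 0"
      then show "sqrt (r\<^sup>2 * (r\<^sup>2 + 6) / (r^4 + 7 * r\<^sup>2 + 19)) = V r"
        using V_sq[of r] V_pos[of r] by (intro real_sqrt_unique) (auto simp: N_def D_def)
    qed
    ultimately show ?thesis using Lim_transform_eventually by fastforce
  qed
  have "V r \<le> U r"
    using assms(2) cont(1)
    by (intro subsolution_le_vortex_profile[OF assms(1), of V V' V'' \<rho>] dV dV' sub V_pos V'0 lim)
      (auto simp: V_def continuous_on_eq_continuous_within intro: continuous_at_imp_continuous_at_within)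
  then have "(V r)\<^sup>2 \<le> (U r)\<^sup>2" using V_pos[OF assms(2)] by (intro power_mono) auto
  then show ?thesis by (simp add: V_sq N_def D_def)
qed

text \<open>Inserting the rational lower bound for U^2 and multiplying by r (r^4 + 7 r^2 + 19)
  leaves a quintic to be shown nonnegative for r > 0. It is smallest close to r = 1.41, so a
  multiple of (r - 141/100)^2 is split off and the remainder has only positive coefficients. The
  number 149/50 is 67/50 + 41/25.\<close>

lemma vortex_potential_ge:
  assumes "vortex_profile U" "r > 0"
  shows "3 * (U r)\<^sup>2 + 12 / 5 / r - 41 / 25 \<ge> 67 / 50"
proof -
  have D: "r^4 + 7 * r\<^sup>2 + 19 > 0" using assms by (intro add_pos_pos) auto
  have "0 \<le> (r - 141/100)\<^sup>2 * (12/5 * r\<^sup>2 + 977/250 * r + 11417/500) + 1/50 * r^5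
      + 2689/12500 * r\<^sup>2 + 5963/2500000 * r + 1018623/5000000"
    using assms(2) by (intro add_nonneg_nonneg mult_nonneg_nonneg) auto
  also have "\<dots> = 3 * r^3 * (r\<^sup>2 + 6) + 12/5 * (r^4 + 7 * r\<^sup>2 + 19) - 149/50 * r * (r^4 + 7 * r\<^sup>2 + 19)"
    by (simp add: power2_eq_square power3_eq_cube power4_eq_xxxx eval_nat_numeral field_simps)
  finally have "149/50 \<le> 3 * (r\<^sup>2 * (r\<^sup>2 + 6) / (r^4 + 7 * r\<^sup>2 + 19)) + 12 / 5 / r"
    using D assms(2) by (simp add: divide_simps) (simp add: algebra_simps power2_eq_square power3_eq_cube power4_eq_xxxx)
  with vortex_profile_sq_ge[OF assms] show ?thesis by simp
qed

section \<open>Semibounded forms\<close>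

text \<open>\<open>D\<close> is only required to be closed under differences, whereas the usual
  proof of Cauchy-Schwarz for a form uses scalar multiples; the inequality is therefore an
  assumption. For the vortex operator it is read off from an integral representation.\<close>

locale semibounded_form =
  fixes M :: "'a measure" and D :: "('a \<Rightarrow> complex) set"
    and A :: "('a \<Rightarrow> complex) \<Rightarrow> 'a \<Rightarrow> complex" and c :: real
  assumes D_L2: "f \<in> D \<Longrightarrow> f \<in> L2 M"
    and A_L2: "f \<in> D \<Longrightarrow> A f \<in> L2 M"
    and D_diff: "f \<in> D \<Longrightarrow> g \<in> D \<Longrightarrow> (\<lambda>x. f x - g x) \<in> D"
    and form_diff: "f \<in> D \<Longrightarrow> g \<in> D \<Longrightarrow> h \<in> D \<Longrightarrow>
      op_form M A (\<lambda>x. f x - g x) h = op_form M A f h - op_form M A g h"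
    and form_commute: "f \<in> D \<Longrightarrow> g \<in> D \<Longrightarrow> op_form M A g f = cnj (op_form M A f g)"
    and form_ge: "f \<in> D \<Longrightarrow> Re (op_form M A f f) \<ge> c * (L2_norm M f)\<^sup>2"
    and c_nonneg: "c \<ge> 0"
    and form_Cauchy_Schwarz: "f \<in> D \<Longrightarrow> g \<in> D \<Longrightarrow>
      cmod (op_form M A f g) \<le> sqrt (Re (op_form M A f f)) * sqrt (Re (op_form M A g g))"
begin

abbreviation "t \<equiv> op_form M A"

lemma form_diff_right:
  assumes "f \<in> D" "g \<in> D" "h \<in> D"
  shows "t h (\<lambda>x. f x - g x) = t h f - t h g"
  using assms by (simp add: form_commute[of _ h] D_diff form_diff)

lemma form_nonneg:
  assumes "f \<in> D"
  shows "Re (t f f) \<ge> 0"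
proof -
  have "0 \<le> c * (L2_norm M f)\<^sup>2" using c_nonneg by simp
  then show ?thesis using form_ge[OF assms] by linarith
qed

lemma form_self_real:
  assumes "f \<in> D"
  shows "t f f = of_real (Re (t f f))"
  using form_commute[OF assms assms] by (simp add: complex_eq_iff)

lemma form_self_diff_le:
  assumes "f \<in> D" "g \<in> D"
  shows "Re (t (\<lambda>x. f x - g x) (\<lambda>x. f x - g x)) \<le> 2 * Re (t f f) + 2 * Re (t g g)"
proof -
  define a b where "a = sqrt (Re (t f f))" and "b = sqrt (Re (t g g))"
  have ab: "a\<^sup>2 = Re (t f f)" "b\<^sup>2 = Re (t g g)"
    using assms form_nonneg by (auto simp: a_def b_def)
  have "Re (t (\<lambda>x. f x - g x) (\<lambda>x. f x - g x)) = Re (t f f) - 2 * Re (t f g) + Re (t g g)"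
    using assms form_commute[of f g] by (simp add: form_diff form_diff_right D_diff)
  moreover have "- Re (t f g) \<le> a * b"
    using form_Cauchy_Schwarz[OF assms] abs_Re_le_cmod[of "t f g"] by (simp add: a_def b_def)
  moreover have "2 * (a * b) \<le> a\<^sup>2 + b\<^sup>2" using sum_squares_bound[of a b] by simp
  ultimately show ?thesis using ab by linarith
qed

lemma form_convergentD:
  assumes "form_convergent M D A \<phi> u"
  shows "u \<in> L2 M" "\<phi> n \<in> D" "(\<lambda>n. L2_norm M (\<lambda>x. \<phi> n x - u x)) \<longlonglongrightarrow> 0"
    "\<epsilon> > 0 \<Longrightarrow> \<exists>N. \<forall>m\<ge>N. \<forall>n\<ge>N. Re (t (\<lambda>x. \<phi> m x - \<phi> n x) (\<lambda>x. \<phi> m x - \<phi> n x)) < \<epsilon>"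
proof -
  show "u \<in> L2 M" "\<phi> n \<in> D" "(\<lambda>n. L2_norm M (\<lambda>x. \<phi> n x - u x)) \<longlonglongrightarrow> 0"
    using assms by (auto simp: form_convergent_def)
  assume "\<epsilon> > 0"
  then obtain N where "\<forall>m\<ge>N. \<forall>n\<ge>N. cmod (t (\<lambda>x. \<phi> m x - \<phi> n x) (\<lambda>x. \<phi> m x - \<phi> n x)) < \<epsilon>"
    using assms by (auto simp: form_convergent_def)
  then show "\<exists>N. \<forall>m\<ge>N. \<forall>n\<ge>N. Re (t (\<lambda>x. \<phi> m x - \<phi> n x) (\<lambda>x. \<phi> m x - \<phi> n x)) < \<epsilon>"
    using complex_Re_le_cmod order_le_less_trans by blast
qed

lemma form_convergent_const:
  assumes "f \<in> D"
  shows "form_convergent M D A (\<lambda>n. f) f"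
proof -
  have "t (\<lambda>x. f x - f x) (\<lambda>x. f x - f x) = 0" "L2_norm M (\<lambda>x. f x - f x) = 0"
    using assms form_diff[OF assms assms D_diff[OF assms assms]] by (auto simp: L2_norm_def)
  then show ?thesis using assms D_L2 by (auto simp: form_convergent_def)
qed

text \<open>This is the closability of the form. For any approximating sequence, h n =
  \<open>\<phi>\<close> n - f tends to 0 in L2 and has bounded form values. Split
  \<open>\<psi>\<close> n at a fixed late member \<open>\<psi>\<close> N: the pairing of h n with
  \<open>\<psi>\<close> N equals, up to conjugation, the inner product of A(\<open>\<psi>\<close> N)
  with h n and vanishes in the limit; the rest is small by Cauchy-Schwarz for the form, since
  \<open>\<psi>\<close> is a Cauchy sequence for it.\<close>

lemma form_op_extends:
  assumes "f \<in> D"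
  shows "form_op M D A f (A f)"
  unfolding form_op_def
proof (intro conjI allI impI exI)
  show "A f \<in> L2 M" using assms by (rule A_L2)
  show "form_convergent M D A (\<lambda>n. f) f" using assms by (rule form_convergent_const)
  fix v \<phi> \<psi> assume \<phi>: "form_convergent M D A \<phi> f" and \<psi>: "form_convergent M D A \<psi> v"
  define h where "h n x = \<phi> n x - f x" for n x
  note \<phi>D = form_convergentD(2)[OF \<phi>] and \<psi>D = form_convergentD(2)[OF \<psi>]
  have hD: "h n \<in> D" for n unfolding h_def using \<phi>D assms by (rule D_diff)
  have h0: "(\<lambda>n. L2_norm M (h n)) \<longlonglongrightarrow> 0"
    using form_convergentD(3)[OF \<phi>] by (simp add: h_def[abs_def])
  obtain N0 where N0: "\<And>n. n \<ge> N0 \<Longrightarrow> Re (t (\<lambda>x. \<phi> n x - \<phi> N0 x) (\<lambda>x. \<phi> n x - \<phi> N0 x)) < 1"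
    using form_convergentD(4)[OF \<phi>, of 1] by auto
  \<comment> \<open>Bounds the form values of h n for n >= N0: both \<open>\<phi>\<close> n and f
    are compared with the base point \<open>\<phi>\<close> N0.\<close>
  define B where "B = 2 + 2 * Re (t (\<lambda>x. f x - \<phi> N0 x) (\<lambda>x. f x - \<phi> N0 x))"
  have B: "Re (t (h n) (h n)) \<le> B" if "n \<ge> N0" for n
  proof -
    have "h n = (\<lambda>x. (\<phi> n x - \<phi> N0 x) - (f x - \<phi> N0 x))" by (auto simp: h_def)
    then show ?thesis
      using form_self_diff_le[OF D_diff[OF \<phi>D[of n] \<phi>D[of N0]] D_diff[OF assms \<phi>D[of N0]]] N0[OF that]
      by (simp add: B_def)
  qed
  have "B > 0" unfolding B_def using form_nonneg[OF D_diff[OF assms \<phi>D[of N0]]] by simp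
  have "(\<lambda>n. t (h n) (\<psi> n)) \<longlonglongrightarrow> 0"
  proof (rule LIMSEQ_I)
    fix e :: real assume "e > 0"
    \<comment> \<open>Chosen so that sqrt B * sqrt d = e / 2.\<close>
    define d where "d = (e / 2)\<^sup>2 / B"
    have "d > 0" using \<open>e > 0\<close> \<open>B > 0\<close> by (simp add: d_def)
    then obtain N where N: "\<And>n. n \<ge> N \<Longrightarrow> Re (t (\<lambda>x. \<psi> n x - \<psi> N x) (\<lambda>x. \<psi> n x - \<psi> N x)) < d"
      using form_convergentD(4)[OF \<psi>, of d] by auto
    have "(\<lambda>n. L2_norm M (A (\<psi> N)) * L2_norm M (h n)) \<longlonglongrightarrow> L2_norm M (A (\<psi> N)) * 0"
      by (intro tendsto_intros h0)
    then have "\<forall>\<^sub>F n in sequentially. L2_norm M (A (\<psi> N)) * L2_norm M (h n) < e / 2"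
      using \<open>e > 0\<close> by (intro order_tendstoD) auto
    then obtain N1 where N1: "\<And>n. n \<ge> N1 \<Longrightarrow> L2_norm M (A (\<psi> N)) * L2_norm M (h n) < e / 2"
      by (auto simp: eventually_sequentially)
    have "cmod (t (h n) (\<psi> n)) < e" if n: "n \<ge> max N (max N0 N1)" for n
    proof -
      let ?k = "\<lambda>x. \<psi> n x - \<psi> N x"
      have "t (h n) (\<psi> n) = t (h n) ?k + cnj (t (\<psi> N) (h n))"
        using form_diff_right[OF \<psi>D[of n] \<psi>D[of N] hD[of n]] form_commute[OF \<psi>D[of N] hD[of n]] by simp
      then have "cmod (t (h n) (\<psi> n)) \<le> cmod (t (h n) ?k) + cmod (t (\<psi> N) (h n))"
        by (metis complex_mod_cnj norm_triangle_ineq)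
      also have "cmod (t (\<psi> N) (h n)) < e / 2"
      proof -
        have "cmod (t (\<psi> N) (h n)) \<le> L2_norm M (A (\<psi> N)) * L2_norm M (h n)"
          unfolding op_form_def by (intro L2_Cauchy_Schwarz A_L2 D_L2 \<psi>D hD)
        then show ?thesis using N1[of n] n by simp
      qed
      also have "cmod (t (h n) ?k) \<le> e / 2"
      proof -
        have "cmod (t (h n) ?k) \<le> sqrt (Re (t (h n) (h n))) * sqrt (Re (t ?k ?k))"
          by (intro form_Cauchy_Schwarz hD D_diff \<psi>D)
        also have "\<dots> \<le> sqrt B * sqrt d"
          using B[of n] N[of n] n form_nonneg[OF hD[of n]] form_nonneg[OF D_diff[OF \<psi>D[of n] \<psi>D[of N]]]
            \<open>B > 0\<close>
          by (intro mult_mono real_sqrt_le_mono) auto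
        also have "\<dots> = e / 2" using \<open>B > 0\<close> \<open>e > 0\<close> by (simp add: d_def real_sqrt_mult[symmetric])
        finally show ?thesis .
      qed
      finally show ?thesis by simp
    qed
    then show "\<exists>no. \<forall>n\<ge>no. cmod (t (h n) (\<psi> n) - 0) < e" by (intro exI[of _ "max N (max N0 N1)"]) simp
  qed
  moreover have "(\<lambda>n. t f (\<psi> n)) \<longlonglongrightarrow> L2_inner M (A f) v"
  proof -
    have "cmod (t f (\<psi> n) - L2_inner M (A f) v) \<le> L2_norm M (A f) * L2_norm M (\<lambda>x. \<psi> n x - v x)" for n
      using L2_Cauchy_Schwarz[OF A_L2[OF assms] L2_diff[OF D_L2[OF \<psi>D[of n]] form_convergentD(1)[OF \<psi>]]]
      by (simp add: op_form_def L2_inner_diff_right[OF D_L2[OF \<psi>D] form_convergentD(1)[OF \<psi>] A_L2[OF assms]])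
    moreover have "(\<lambda>n. L2_norm M (A f) * L2_norm M (\<lambda>x. \<psi> n x - v x)) \<longlonglongrightarrow> L2_norm M (A f) * 0"
      by (intro tendsto_intros form_convergentD(3)[OF \<psi>])
    ultimately show ?thesis
      by - (rule LIM_zero_cancel, rule Lim_null_comparison, auto intro: always_eventually)
  qed
  ultimately have "(\<lambda>n. t (h n) (\<psi> n) + t f (\<psi> n)) \<longlonglongrightarrow> 0 + L2_inner M (A f) v"
    by (rule tendsto_add)
  moreover have "t (h n) (\<psi> n) + t f (\<psi> n) = t (\<phi> n) (\<psi> n)" for n
    using form_diff[OF \<phi>D[of n] assms \<psi>D[of n]] by (simp add: h_def[abs_def])
  ultimately show "(\<lambda>n. t (\<phi> n) (\<psi> n)) \<longlonglongrightarrow> L2_inner M (A f) v" by simp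
qed

text \<open>The eigenvalue equation is tested against u itself along one approximating sequence. The
  real numbers t(\<open>\<phi>\<close> n, \<open>\<phi>\<close> n) converge to z times the squared
  norm of u, and the lower bound of the form passes to the limit.\<close>

lemma eigenvalue_form_op_ge:
  assumes "eigenvalue M (form_op M D A) z"
  obtains x where "z = of_real x" "x \<ge> c"
proof -
  obtain u where u: "form_op M D A u (\<lambda>x. z * u x)" "\<not> (AE x in M. u x = 0)"
    using assms by (auto simp: eigenvalue_def eigenspace_def)
  obtain \<phi> where \<phi>: "form_convergent M D A \<phi> u" using u(1) by (auto simp: form_op_def)
  note uL2 = form_convergentD(1)[OF \<phi>] and \<phi>D = form_convergentD(2)[OF \<phi>]
  define N where "N = (L2_norm M u)\<^sup>2"
  have "N > 0" using L2_norm_eq_0_iff[OF uL2] u(2) by (simp add: N_def)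
  have "(\<lambda>n. t (\<phi> n) (\<phi> n)) \<longlonglongrightarrow> L2_inner M (\<lambda>x. z * u x) u"
    using u(1) \<phi> by (auto simp: form_op_def)
  also have "L2_inner M (\<lambda>x. z * u x) u = z * of_real N"
    using L2_inner_self[of M u] by (simp add: N_def L2_inner_def mult.assoc)
  finally have lim: "(\<lambda>n. t (\<phi> n) (\<phi> n)) \<longlonglongrightarrow> z * of_real N" .
  have "(\<lambda>n. Im (t (\<phi> n) (\<phi> n))) \<longlonglongrightarrow> Im (z * of_real N)" by (intro tendsto_Im lim)
  moreover have "Im (t (\<phi> n) (\<phi> n)) = 0" for n
    using form_self_real[OF \<phi>D[of n]] by (metis Im_complex_of_real)
  ultimately have "(\<lambda>n. 0) \<longlonglongrightarrow> Im (z * of_real N)" by simp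
  then have "Im (z * of_real N) = 0" using LIMSEQ_unique tendsto_const by blast
  then have "Im z = 0" using \<open>N > 0\<close> by simp
  have "(\<lambda>n. Re (t (\<phi> n) (\<phi> n))) \<longlonglongrightarrow> Re (z * of_real N)" by (intro tendsto_Re lim)
  \<comment> \<open>Truncation at 0 makes the lower bound for the norm of \<open>\<phi>\<close> n
    nonnegative, so that it may be squared for every n.\<close>
  moreover have "(\<lambda>n. c * (max 0 (L2_norm M u - L2_norm M (\<lambda>x. \<phi> n x - u x)))\<^sup>2)
      \<longlonglongrightarrow> c * (max 0 (L2_norm M u - 0))\<^sup>2"
    by (intro tendsto_intros form_convergentD(3)[OF \<phi>])
  moreover have "c * (max 0 (L2_norm M u - L2_norm M (\<lambda>x. \<phi> n x - u x)))\<^sup>2 \<le> Re (t (\<phi> n) (\<phi> n))" for n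
  proof -
    have "c * (max 0 (L2_norm M u - L2_norm M (\<lambda>x. \<phi> n x - u x)))\<^sup>2 \<le> c * (L2_norm M (\<phi> n))\<^sup>2"
      using L2_norm_le_add_diff[OF D_L2[OF \<phi>D[of n]] uL2] c_nonneg
      by (intro mult_left_mono power_mono) auto
    also have "\<dots> \<le> Re (t (\<phi> n) (\<phi> n))" by (rule form_ge[OF \<phi>D])
    finally show ?thesis .
  qed
  ultimately have "c * (max 0 (L2_norm M u - 0))\<^sup>2 \<le> Re (z * of_real N)"
    by (intro LIMSEQ_le) auto
  then have "c * N \<le> Re z * N" by (simp add: N_def)
  then have "Re z \<ge> c" using \<open>N > 0\<close> by simp
  then show ?thesis using \<open>Im z = 0\<close> by (intro that[of "Re z"]) (auto simp: complex_eq_iff)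
qed

end

section \<open>Integration by parts on the half-line\<close>

text \<open>The support stays away from 0, so the class is stable under multiplication by
  coefficients singular there, such as 1/r^2. No derivatives are demanded: a test function and its
  first two derivatives all belong to it.\<close>

definition Cc_half_line :: "(real \<Rightarrow> 'a::real_normed_vector) \<Rightarrow> bool" where
  "Cc_half_line f \<longleftrightarrow> continuous_on {0<..} f \<and> (\<exists>a b. 0 < a \<and> a < b \<and> (\<forall>r. r \<notin> {a..b} \<longrightarrow> f r = 0))"

lemma Cc_half_lineE:
  assumes "Cc_half_line f"
  obtains a b where "0 < a" "a < b" "\<And>r. r \<notin> {a..b} \<Longrightarrow> f r = 0" "continuous_on {0<..} f"
  using assms by (auto simp: Cc_half_line_def)

lemma Cc_half_line_continuous: "Cc_half_line f \<Longrightarrow> continuous_on {0<..} f"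
  by (simp add: Cc_half_line_def)

lemma Cc_half_line_transform:
  assumes "Cc_half_line f" "continuous_on {0<..} g" "\<And>r. f r = 0 \<Longrightarrow> g r = 0"
  shows "Cc_half_line g"
  using assms by (fastforce simp: Cc_half_line_def)

lemma Cc_half_line_combine:
  assumes f: "Cc_half_line f" and g: "Cc_half_line g"
    and h: "continuous_on {0<..} h" "\<And>r. f r = 0 \<Longrightarrow> g r = 0 \<Longrightarrow> h r = 0"
  shows "Cc_half_line h"
proof -
  obtain a b where "0 < a" "a < b" "\<And>r. r \<notin> {a..b} \<Longrightarrow> f r = 0"
    by (rule Cc_half_lineE[OF f]) blast
  moreover obtain a' b' where "0 < a'" "a' < b'" "\<And>r. r \<notin> {a'..b'} \<Longrightarrow> g r = 0"
    by (rule Cc_half_lineE[OF g]) blast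
  ultimately have "0 < min a a'" "min a a' < max b b'" "\<forall>r. r \<notin> {min a a'..max b b'} \<longrightarrow> h r = 0"
    by (auto simp: min_le_iff_disj le_max_iff_disj intro!: h(2))
  then show ?thesis unfolding Cc_half_line_def using h(1) by blast
qed

lemma Cc_half_line_mult:
  fixes c f :: "real \<Rightarrow> 'a::real_normed_algebra"
  assumes "continuous_on {0<..} c" "Cc_half_line f"
  shows "Cc_half_line (\<lambda>r. c r * f r)"
  by (rule Cc_half_line_transform[OF assms(2)])
    (auto intro!: continuous_intros assms(1) Cc_half_line_continuous[OF assms(2)])

lemma Cc_half_line_add:
  assumes "Cc_half_line f" "Cc_half_line g"
  shows "Cc_half_line (\<lambda>r. f r + g r)"
  by (rule Cc_half_line_combine[OF assms])
    (auto intro!: continuous_intros assms[THEN Cc_half_line_continuous])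

lemma Cc_half_line_diff:
  assumes "Cc_half_line f" "Cc_half_line g"
  shows "Cc_half_line (\<lambda>r. f r - g r)"
  by (rule Cc_half_line_combine[OF assms])
    (auto intro!: continuous_intros assms[THEN Cc_half_line_continuous])

lemma Cc_half_line_mult_cnj:
  assumes "Cc_half_line f" "Cc_half_line g"
  shows "Cc_half_line (\<lambda>r. f r * cnj (g r))"
  by (rule Cc_half_line_transform[OF assms(1)])
    (auto intro!: continuous_intros assms[THEN Cc_half_line_continuous])

lemma Cc_half_line_norm_sq:
  assumes "Cc_half_line f"
  shows "Cc_half_line (\<lambda>r. (norm (f r))\<^sup>2)"
  by (rule Cc_half_line_transform[OF assms])
    (auto intro!: continuous_intros Cc_half_line_continuous[OF assms])

lemma space_radial_measure: "space radial_measure = {0<..}"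
  by (simp add: radial_measure_def space_restrict_space)

lemma borel_measurable_radial:
  assumes "continuous_on {0<..} f"
  shows "f \<in> borel_measurable radial_measure"
proof -
  have "f \<in> borel_measurable (restrict_space borel {0<..})"
    using assms by (rule borel_measurable_continuous_on_restrict)
  moreover have "sets radial_measure = sets (restrict_space borel {0<..})"
    by (simp add: radial_measure_def sets_restrict_space)
  ultimately show ?thesis using measurable_cong_sets[of radial_measure] by blast
qed

lemma
  fixes f :: "real \<Rightarrow> 'a::euclidean_space"
  assumes f: "f \<in> borel_measurable radial_measure"
  shows integrable_radial_iff: "integrable radial_measure f \<longleftrightarrow>
      integrable lborel (\<lambda>r. indicator {0<..} r *\<^sub>R (r *\<^sub>R f r))"
    and integral_radial: "(LINT r|radial_measure. f r) =
      (LINT r|lborel. indicator {0<..} r *\<^sub>R (r *\<^sub>R f r))"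
proof -
  let ?N = "restrict_space lborel {0<..} :: real measure"
  have f': "f \<in> borel_measurable ?N"
    using f by (simp add: radial_measure_def)
  have g: "(\<lambda>r. r) \<in> borel_measurable ?N" "AE r in ?N. 0 \<le> r"
    by (auto intro!: AE_I2 measurable_restrict_space1 simp: space_restrict_space)
  show "integrable radial_measure f \<longleftrightarrow>
      integrable lborel (\<lambda>r. indicator {0<..} r *\<^sub>R (r *\<^sub>R f r))"
    unfolding radial_measure_def integrable_density[OF f' g]
    by (subst integrable_restrict_space) auto
  show "(LINT r|radial_measure. f r) = (LINT r|lborel. indicator {0<..} r *\<^sub>R (r *\<^sub>R f r))"
    unfolding radial_measure_def integral_density[OF f' g]
    by (subst integral_restrict_space) auto
qed

lemma integrable_radial:
  fixes f :: "real \<Rightarrow> 'a::euclidean_space"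
  assumes "Cc_half_line f"
  shows "integrable radial_measure f"
proof -
  obtain a b where ab: "0 < a" "a < b" "\<And>r. r \<notin> {a..b} \<Longrightarrow> f r = 0" "continuous_on {0<..} f"
    by (rule Cc_half_lineE[OF assms]) blast
  have "continuous_on {a..b} (\<lambda>r. r *\<^sub>R f r)"
    using ab by (intro continuous_intros continuous_on_subset[OF ab(4)]) auto
  then have "integrable lborel (\<lambda>r. indicator {a..b} r *\<^sub>R (r *\<^sub>R f r))"
    by (intro borel_integrable_compact) auto
  also have "(\<lambda>r. indicator {a..b} r *\<^sub>R (r *\<^sub>R f r)) = (\<lambda>r. indicator {0<..} r *\<^sub>R (r *\<^sub>R f r))"
    using ab(1-3) by (force simp: indicator_def)
  finally show ?thesis using integrable_radial_iff[OF borel_measurable_radial[OF ab(4)]] by simp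
qed

text \<open>Integration by parts in divergence form: f r dr is the exact differential of F, and F
  vanishes at both ends of an interval reaching beyond the two supports.\<close>

lemma integral_radial_eq_0:
  fixes f F :: "real \<Rightarrow> 'a::euclidean_space"
  assumes f: "Cc_half_line f" and F: "Cc_half_line F"
    and der: "\<And>r. r > 0 \<Longrightarrow> (F has_vector_derivative r *\<^sub>R f r) (at r)"
  shows "(LINT r|radial_measure. f r) = 0"
proof -
  obtain a b where ab: "0 < a" "a < b" "\<And>r. r \<notin> {a..b} \<Longrightarrow> f r = 0"
    by (rule Cc_half_lineE[OF f]) blast
  obtain a' b' where ab': "0 < a'" "a' < b'" "\<And>r. r \<notin> {a'..b'} \<Longrightarrow> F r = 0"
    by (rule Cc_half_lineE[OF F]) blast
  define A where "A = min a a' / 2"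
  define B where "B = max b b' + 1"
  have AB: "0 < A" "A \<le> B" "A < a" "A < a'" "b < B" "b' < B"
    using ab ab' by (auto simp: A_def B_def min_def max_def)
  have "(LINT r|radial_measure. f r) = (LINT r|lborel. indicator {0<..} r *\<^sub>R (r *\<^sub>R f r))"
    by (rule integral_radial[OF borel_measurable_radial[OF Cc_half_line_continuous[OF f]]])
  also have "(\<lambda>r. indicator {0<..} r *\<^sub>R (r *\<^sub>R f r)) = (\<lambda>r. indicator {A..B} r *\<^sub>R (r *\<^sub>R f r))"
    using ab AB by (force simp: indicator_def)
  also have "(LINT r|lborel. indicator {A..B} r *\<^sub>R (r *\<^sub>R f r)) = F B - F A"
  proof (rule integral_FTC_atLeastAtMost[OF AB(2)])
    show "continuous_on {A..B} (\<lambda>r. r *\<^sub>R f r)"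
      using AB by (intro continuous_intros continuous_on_subset[OF Cc_half_line_continuous[OF f]]) auto
    fix r assume "A \<le> r" "r \<le> B"
    then have "r > 0" using AB by simp
    then show "(F has_vector_derivative r *\<^sub>R f r) (at r within {A..B})"
      by (rule has_vector_derivative_at_within[OF der])
  qed
  also have "\<dots> = 0" using ab'(3) AB by simp
  finally show ?thesis .
qed

lemma L2_radial: "Cc_half_line f \<Longrightarrow> f \<in> L2 radial_measure"
  by (simp add: L2_def borel_measurable_radial Cc_half_line_continuous integrable_radial
      Cc_half_line_norm_sq)

section \<open>Test functions\<close>

lemma has_vector_derivative_0_off_support:
  assumes "closed K" "\<And>y. y \<notin> K \<Longrightarrow> f y = 0" "x \<notin> K"
  shows "(f has_vector_derivative 0) (at x)"
proof (rule has_vector_derivative_transform_within_open[of "\<lambda>r. 0" _ _ "- K"])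
  show "open (- K)" using assms(1) by (rule open_Compl)
qed (use assms in auto)

text \<open>\<open>smooth_on\<close> gives derivatives on the positive half-line only, while
  \<open>L1_expr\<close> uses the total \<open>vector_derivative\<close>. The two agree for r > 0;
  off the support, and in particular for r <= 0, the function vanishes near r and so do its
  derivatives.\<close>

lemma test_functions_deriv:
  assumes "f \<in> test_functions"
  defines "f1 \<equiv> \<lambda>r. vector_derivative f (at r)"
  defines "f2 \<equiv> \<lambda>r. vector_derivative f1 (at r)"
  shows "Cc_half_line f" "Cc_half_line f1" "Cc_half_line f2"
    and "\<And>r. r > 0 \<Longrightarrow> (f has_vector_derivative f1 r) (at r)"
    and "\<And>r. r > 0 \<Longrightarrow> (f1 has_vector_derivative f2 r) (at r)"
proof -
  have at: "at r within {0<..} = at r" if "r > 0" for r :: real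
    using that by (intro at_within_open) auto
  obtain D where D0: "D 0 = f"
    and D: "\<And>k r. r > 0 \<Longrightarrow> (D k has_vector_derivative D (Suc k) r) (at r)"
    using assms(1) unfolding test_functions_def smooth_on_def by (auto simp: at)
  obtain K where K: "compact K" "K \<subseteq> {0<..}" "\<And>r. r \<notin> K \<Longrightarrow> f r = 0"
    using assms(1) by (auto simp: test_functions_def)
  obtain a b where ab: "0 < a" "a < b" "K \<subseteq> {a..b}"
  proof (cases "K = {}")
    case False
    obtain a b where "a \<in> K" "\<forall>x\<in>K. a \<le> x" "b \<in> K" "\<forall>x\<in>K. x \<le> b"
      using compact_attains_inf[OF K(1) False] compact_attains_sup[OF K(1) False] by blast
    moreover from this have "0 < a" "a < b + 1" using K(2) by force+
    ultimately show ?thesis by (intro that[of a "b + 1"]) (auto intro: add_increasing2)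
  next
    case True
    then show ?thesis by (intro that[of 1 2]) auto
  qed
  have f0: "f r = 0" if "r \<notin> {a..b}" for r using that ab(3) K(3) by blast
  have f1_D: "f1 r = D 1 r" if "r > 0" for r
    unfolding f1_def using vector_derivative_at[OF D[of r 0]] that by (simp add: D0)
  show f1: "(f has_vector_derivative f1 r) (at r)" if "r > 0" for r
    using D[OF that, of 0] f1_D[OF that] by (simp add: D0)
  have der_f1: "(f1 has_vector_derivative D 2 r) (at r)" if "r > 0" for r
    by (rule has_vector_derivative_transform_within_open[of "D 1" _ _ "{0<..}"])
      (use that f1_D D[OF that, of 1] in \<open>auto simp: numeral_2_eq_2\<close>)
  have f2_D: "f2 r = D 2 r" if "r > 0" for r
    unfolding f2_def using vector_derivative_at[OF der_f1[OF that]] .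
  show "(f1 has_vector_derivative f2 r) (at r)" if "r > 0" for r
    using der_f1[OF that] f2_D[OF that] by simp
  have contD: "continuous_on {0<..} (D k)" for k
    using has_vector_derivative_continuous[OF D]
    by (auto intro!: continuous_at_imp_continuous_on)
  have f10: "f1 r = 0" if "r \<notin> {a..b}" for r
    unfolding f1_def using has_vector_derivative_0_off_support[of "{a..b}" f r] that f0
    by (intro vector_derivative_at) auto
  have f20: "f2 r = 0" if "r \<notin> {a..b}" for r
    unfolding f2_def using has_vector_derivative_0_off_support[of "{a..b}" f1 r] that f10
    by (intro vector_derivative_at) auto
  have cont: "continuous_on {0<..} f" "continuous_on {0<..} f1" "continuous_on {0<..} f2"
    using contD[of 0] contD[of 1] contD[of 2] f1_D f2_D D0
      continuous_on_cong[of "{0<..}" "{0<..}" f1 "D 1"] continuous_on_cong[of "{0<..}" "{0<..}" f2 "D 2"]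
    by auto
  show "Cc_half_line f" "Cc_half_line f1" "Cc_half_line f2"
    unfolding Cc_half_line_def using ab cont f0 f10 f20 by blast+
qed

lemma test_functions_diff:
  assumes "f \<in> test_functions" "g \<in> test_functions"
  shows "(\<lambda>r. f r - g r) \<in> test_functions"
proof -
  obtain K K' where "compact K" "K \<subseteq> {0<..}" "\<forall>r. r \<notin> K \<longrightarrow> f r = 0"
    "compact K'" "K' \<subseteq> {0<..}" "\<forall>r. r \<notin> K' \<longrightarrow> g r = 0"
    using assms by (auto simp: test_functions_def)
  then have "compact (K \<union> K')" "K \<union> K' \<subseteq> {0<..}" "\<forall>r. r \<notin> K \<union> K' \<longrightarrow> f r - g r = 0"
    by auto
  moreover have "smooth_on {0<..} (\<lambda>r. f r - g r)"
    using assms by (intro smooth_on_diff) (auto simp: test_functions_def)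
  ultimately show ?thesis unfolding test_functions_def by blast
qed

section \<open>The form of \<open>\<L>\<^sub>1\<close>\<close>

text \<open>With the weight \<open>g(r) = 1 / r - 4 / 5\<close>, the logarithmic derivative of \<open>r e\<^sup>-\<^sup>4\<^sup>r\<^sup>/\<^sup>5\<close>,
  integration by parts writes the form as \<open>\<integral> (|f' - g f|\<^sup>2 + Q |f|\<^sup>2) r dr\<close>, where
  \<open>Q = (1 / r\<^sup>2 - 1 + 3 U\<^sup>2) - g' - g / r - g\<^sup>2\<close>.\<close>

definition twisted_deriv :: "(real \<Rightarrow> complex) \<Rightarrow> real \<Rightarrow> complex" where
  "twisted_deriv f r = vector_derivative f (at r) - of_real (1 / r - 4 / 5) * f r"

locale vortex =
  fixes U :: "real \<Rightarrow> real"
  assumes vortex: "vortex_profile U"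
begin

lemma continuous_on_U: "continuous_on {0<..} U"
  by (rule vortex_profileE[OF vortex], rule continuous_on_subset[of "{0..}"], rule DERIV_continuous_on) auto

definition Q :: "real \<Rightarrow> real" where
  "Q r = 3 * (U r)\<^sup>2 + 12 / 5 / r - 41 / 25"

lemma Q_ge: "r > 0 \<Longrightarrow> Q r \<ge> 67 / 50"
  unfolding Q_def by (rule vortex_potential_ge[OF vortex])

lemma continuous_on_Q: "continuous_on {0<..} (\<lambda>r. complex_of_real (Q r))"
  unfolding Q_def by (intro continuous_intros continuous_on_U) auto

lemma Cc_L1_expr:
  assumes "f \<in> test_functions"
  shows "Cc_half_line (L1_expr U f)"
  unfolding L1_expr_def
proof -
  note d = test_functions_deriv[OF assms]
  have c: "continuous_on {0<..} (\<lambda>r. - 1 :: complex)"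
    "continuous_on {0<..} (\<lambda>r. complex_of_real (1 / r))"
    "continuous_on {0<..} (\<lambda>r. complex_of_real (1 / r\<^sup>2))"
    "continuous_on {0<..} (\<lambda>r. complex_of_real (1 - 3 * (U r)\<^sup>2))"
    by (intro continuous_intros continuous_on_U; simp)+
  show "Cc_half_line (\<lambda>r. - vector_derivative (\<lambda>s. vector_derivative f (at s)) (at r)
     - of_real (1 / r) * vector_derivative f (at r) + of_real (1 / r\<^sup>2) * f r
     - of_real (1 - 3 * (U r)\<^sup>2) * f r)"
    using Cc_half_line_diff[OF Cc_half_line_add[OF Cc_half_line_diff[OF
      Cc_half_line_mult[OF c(1) d(3)] Cc_half_line_mult[OF c(2) d(2)]]
      Cc_half_line_mult[OF c(3) d(1)]] Cc_half_line_mult[OF c(4) d(1)]] by simp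
qed

lemma Cc_twisted_deriv:
  assumes "f \<in> test_functions"
  shows "Cc_half_line (twisted_deriv f)"
  unfolding twisted_deriv_def[abs_def]
  by (intro Cc_half_line_diff Cc_half_line_mult test_functions_deriv[OF assms] continuous_intros) auto

lemma L1_form_eq:
  assumes f: "f \<in> test_functions" and g: "g \<in> test_functions"
  shows "op_form radial_measure (L1_expr U) f g =
    (LINT r|radial_measure. twisted_deriv f r * cnj (twisted_deriv g r)) +
    (LINT r|radial_measure. of_real (Q r) * (f r * cnj (g r)))"
proof -
  note df = test_functions_deriv[OF f] and dg = test_functions_deriv[OF g]
  let ?f1 = "\<lambda>r. vector_derivative f (at r)" and ?g1 = "\<lambda>r. vector_derivative g (at r)"
  \<comment> \<open>The boundary term r (f' - (1/r - 4/5) f) cnj g, multiplied out to remove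
    1/r.\<close>
  define F where "F r = of_real r * (?f1 r * cnj (g r)) - of_real (1 - 4 / 5 * r) * (f r * cnj (g r))" for r
  define A where "A r = L1_expr U f r * cnj (g r)" for r
  define B where "B r = twisted_deriv f r * cnj (twisted_deriv g r)" for r
  define C where "C r = of_real (Q r) * (f r * cnj (g r))" for r
  have Cc: "Cc_half_line A" "Cc_half_line B" "Cc_half_line C" "Cc_half_line F"
    unfolding A_def[abs_def] B_def[abs_def] C_def[abs_def] F_def[abs_def]
    by (intro Cc_half_line_mult_cnj Cc_half_line_mult Cc_half_line_diff continuous_on_Q
        Cc_L1_expr Cc_twisted_deriv f g df dg continuous_intros)+
  have "(LINT r|radial_measure. B r + C r - A r) = 0"
  proof (rule integral_radial_eq_0)
    show "Cc_half_line (\<lambda>r. B r + C r - A r)" by (intro Cc_half_line_add Cc_half_line_diff Cc)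
    show "Cc_half_line F" by (rule Cc)
    fix r :: real assume "r > 0"
    have dcnj: "((\<lambda>r. cnj (g r)) has_vector_derivative cnj (?g1 r)) (at r)"
      using dg(4)[OF \<open>r > 0\<close>] by (rule bounded_linear.has_vector_derivative[OF bounded_linear_cnj])
    have dr: "((\<lambda>r. complex_of_real r) has_vector_derivative 1) (at r)"
      using bounded_linear.has_vector_derivative[OF bounded_linear_of_real has_vector_derivative_id] by simp
    have dr': "((\<lambda>r. complex_of_real (1 - 4 / 5 * r)) has_vector_derivative of_real (- 4 / 5)) (at r)"
      by (rule bounded_linear.has_vector_derivative[OF bounded_linear_of_real])
        (auto intro!: derivative_eq_intros simp: has_real_derivative_iff_has_vector_derivative[symmetric])
    have "(F has_vector_derivative
        (of_real r * (?f1 r * cnj (?g1 r) + vector_derivative ?f1 (at r) * cnj (g r)) + 1 * (?f1 r * cnj (g r))) -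
        (of_real (1 - 4 / 5 * r) * (f r * cnj (?g1 r) + ?f1 r * cnj (g r)) + of_real (- 4 / 5) * (f r * cnj (g r)))) (at r)"
      unfolding F_def[abs_def]
      by (intro has_vector_derivative_diff has_vector_derivative_mult dr dr' dcnj
          df(4)[OF \<open>r > 0\<close>] df(5)[OF \<open>r > 0\<close>])
    also have "(of_real r * (?f1 r * cnj (?g1 r) + vector_derivative ?f1 (at r) * cnj (g r)) + 1 * (?f1 r * cnj (g r))) -
        (of_real (1 - 4 / 5 * r) * (f r * cnj (?g1 r) + ?f1 r * cnj (g r)) + of_real (- 4 / 5) * (f r * cnj (g r)))
        = r *\<^sub>R (B r + C r - A r)"
      using \<open>r > 0\<close>
      by (simp add: A_def B_def C_def L1_expr_def twisted_deriv_def Q_def scaleR_conv_of_real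
          field_simps power2_eq_square)
    finally show "(F has_vector_derivative r *\<^sub>R (B r + C r - A r)) (at r)" .
  qed
  then have "(LINT r|radial_measure. B r) + (LINT r|radial_measure. C r) - (LINT r|radial_measure. A r) = 0"
    using Cc[THEN integrable_radial] by simp
  then show ?thesis
    by (simp add: op_form_def L2_inner_def A_def[abs_def] B_def[abs_def] C_def[abs_def])
qed

lemma L1_form_self:
  assumes f: "f \<in> test_functions"
  shows "op_form radial_measure (L1_expr U) f f = of_real
    (LINT r|radial_measure. (cmod (twisted_deriv f r))\<^sup>2 + Q r * (cmod (f r))\<^sup>2)"
    and "integrable radial_measure (\<lambda>r. (cmod (twisted_deriv f r))\<^sup>2 + Q r * (cmod (f r))\<^sup>2)"
proof -
  have contQ: "continuous_on {0<..} Q"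
    unfolding Q_def[abs_def] by (intro continuous_intros continuous_on_U) auto
  have int: "integrable radial_measure (\<lambda>r. (cmod (twisted_deriv f r))\<^sup>2)"
    "integrable radial_measure (\<lambda>r. Q r * (cmod (f r))\<^sup>2)"
    by (intro integrable_radial Cc_half_line_norm_sq Cc_half_line_mult contQ Cc_twisted_deriv
        test_functions_deriv f)+
  show "op_form radial_measure (L1_expr U) f f = of_real
    (LINT r|radial_measure. (cmod (twisted_deriv f r))\<^sup>2 + Q r * (cmod (f r))\<^sup>2)"
    unfolding L1_form_eq[OF f f] using int
    by (simp add: complex_norm_square[symmetric] del: of_real_power of_real_mult
        flip: of_real_mult)
  show "integrable radial_measure (\<lambda>r. (cmod (twisted_deriv f r))\<^sup>2 + Q r * (cmod (f r))\<^sup>2)"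
    using int by simp
qed

sublocale semibounded_form radial_measure test_functions "L1_expr U" "67 / 50"
proof
  show "f \<in> L2 radial_measure" if "f \<in> test_functions" for f
    by (intro L2_radial test_functions_deriv that)
  show A: "L1_expr U f \<in> L2 radial_measure" if "f \<in> test_functions" for f
    by (intro L2_radial Cc_L1_expr that)
  show "(\<lambda>x. f x - g x) \<in> test_functions" if "f \<in> test_functions" "g \<in> test_functions" for f g
    using that by (rule test_functions_diff)
  show "op_form radial_measure (L1_expr U) (\<lambda>x. f x - g x) h =
      op_form radial_measure (L1_expr U) f h - op_form radial_measure (L1_expr U) g h"
    if f: "f \<in> test_functions" and g: "g \<in> test_functions" and h: "h \<in> test_functions" for f g h
  proof -
    note df = test_functions_deriv[OF f] and dg = test_functions_deriv[OF g]
    \<comment> \<open>\<open>vector_derivative\<close> is additive only where derivatives exist,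
      which is known for r > 0; \<open>radial_measure\<close> lives there.\<close>
    have "L1_expr U (\<lambda>x. f x - g x) r = L1_expr U f r - L1_expr U g r" if "r > 0" for r
    proof -
      have d1: "vector_derivative (\<lambda>x. f x - g x) (at s) = vector_derivative f (at s) - vector_derivative g (at s)"
        if "s > 0" for s
        using that df(4) dg(4) by (intro vector_derivative_at has_vector_derivative_diff) auto
      have "((\<lambda>s. vector_derivative (\<lambda>x. f x - g x) (at s)) has_vector_derivative
          vector_derivative (\<lambda>s. vector_derivative f (at s)) (at r) -
          vector_derivative (\<lambda>s. vector_derivative g (at s)) (at r)) (at r)"
        by (rule has_vector_derivative_transform_within_open[OF
            has_vector_derivative_diff[OF df(5)[OF \<open>r > 0\<close>] dg(5)[OF \<open>r > 0\<close>]], of "{0<..}"])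
          (use \<open>r > 0\<close> d1 in auto)
      then show ?thesis
        by (simp add: L1_expr_def vector_derivative_at d1[OF \<open>r > 0\<close>] right_diff_distrib
            diff_divide_distrib)
    qed
    then have "L2_inner radial_measure (L1_expr U (\<lambda>x. f x - g x)) h =
        L2_inner radial_measure (\<lambda>r. L1_expr U f r - L1_expr U g r) h"
      unfolding L2_inner_def by (intro Bochner_Integration.integral_cong) (auto simp: space_radial_measure)
    then show ?thesis
      unfolding op_form_def
      using A[OF f] A[OF g] L2_radial[OF test_functions_deriv(1)[OF h]] by (simp add: L2_inner_diff_left)
  qed
  show "op_form radial_measure (L1_expr U) g f = cnj (op_form radial_measure (L1_expr U) f g)"
    if "f \<in> test_functions" "g \<in> test_functions" for f g
    using L2_inner_commute[of radial_measure "twisted_deriv g" "twisted_deriv f"]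
      L2_inner_commute[of radial_measure g "\<lambda>r. of_real (Q r) * f r"]
    by (simp add: L1_form_eq that L2_inner_def mult_ac)
  have nonneg: "Q r * (cmod w)\<^sup>2 \<ge> 67 / 50 * (cmod w)\<^sup>2" if "r > 0" for r w
    using Q_ge[OF that] by (intro mult_right_mono) auto
  show "67 / 50 * (L2_norm radial_measure f)\<^sup>2 \<le> Re (op_form radial_measure (L1_expr U) f f)"
    if "f \<in> test_functions" for f
  proof -
    have "67 / 50 * (L2_norm radial_measure f)\<^sup>2 = (LINT r|radial_measure. 67 / 50 * (cmod (f r))\<^sup>2)"
      by (simp add: L2_norm_sq)
    also have "\<dots> \<le> (LINT r|radial_measure. (cmod (twisted_deriv f r))\<^sup>2 + Q r * (cmod (f r))\<^sup>2)"
      using nonneg L1_form_self(2)[OF that] L2_D(2)[OF L2_radial[OF test_functions_deriv(1)[OF that]]]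
      by (intro integral_mono) (auto simp: space_radial_measure intro!: add_increasing)
    finally show ?thesis by (simp add: L1_form_self(1)[OF that])
  qed
  show "cmod (op_form radial_measure (L1_expr U) f g) \<le>
      sqrt (Re (op_form radial_measure (L1_expr U) f f)) * sqrt (Re (op_form radial_measure (L1_expr U) g g))"
    if f: "f \<in> test_functions" and g: "g \<in> test_functions" for f g
  proof -
    \<comment> \<open>The density of the form. Since Q >= 0, the weighted-mean inequality applies to
      both summands of the representation with the same e, and the integrated inequality is
      optimised as for the inner product of L2.\<close>
    define q where "q f r = (cmod (twisted_deriv f r))\<^sup>2 + Q r * (cmod (f r))\<^sup>2" for f r
    have q_nonneg: "q f r \<ge> 0" if "r > 0" for f r
      using Q_ge[OF that] by (auto simp: q_def)
    have q_int: "(LINT r|radial_measure. q f r) \<ge> 0" for f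
      using q_nonneg by (intro integral_nonneg_AE AE_I2) (auto simp: space_radial_measure)
    have q: "Re (op_form radial_measure (L1_expr U) f f) = (LINT r|radial_measure. q f r)"
      "integrable radial_measure (q f)" if "f \<in> test_functions" for f
      using L1_form_self[OF that] by (auto simp: q_def[abs_def])
    let ?h = "\<lambda>r. twisted_deriv f r * cnj (twisted_deriv g r) + of_real (Q r) * (f r * cnj (g r))"
    have "Cc_half_line (\<lambda>r. twisted_deriv f r * cnj (twisted_deriv g r))"
      "Cc_half_line (\<lambda>r. complex_of_real (Q r) * (f r * cnj (g r)))"
      by (intro Cc_half_line_mult_cnj Cc_half_line_mult Cc_twisted_deriv continuous_on_Q
          test_functions_deriv f g)+
    then have int: "integrable radial_measure ?h"
      "op_form radial_measure (L1_expr U) f g = (LINT r|radial_measure. ?h r)"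
      using L1_form_eq[OF f g] by (simp_all add: integrable_radial)
    show ?thesis unfolding q[OF f] q[OF g]
    proof (rule le_mult_if_le_weighted_mean)
      fix e :: real assume "e > 0"
      have "cmod (op_form radial_measure (L1_expr U) f g) \<le> (LINT r|radial_measure. cmod (?h r))"
        unfolding int(2) by (rule integral_norm_bound)
      also have "\<dots> \<le> (LINT r|radial_measure. (e * q f r + q g r / e) / 2)"
      proof (rule integral_mono)
        fix r assume "r \<in> space radial_measure"
        then have "Q r \<ge> 0" using Q_ge[of r] by (simp add: space_radial_measure)
        have "cmod (?h r) \<le> cmod (twisted_deriv f r * cnj (twisted_deriv g r)) + Q r * cmod (f r * cnj (g r))"
          using norm_triangle_ineq[of "twisted_deriv f r * cnj (twisted_deriv g r)"
              "of_real (Q r) * (f r * cnj (g r))"] \<open>Q r \<ge> 0\<close> by (simp add: norm_mult)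
        also have "\<dots> \<le> (e * (cmod (twisted_deriv f r))\<^sup>2 + (cmod (twisted_deriv g r))\<^sup>2 / e) / 2
            + Q r * ((e * (cmod (f r))\<^sup>2 + (cmod (g r))\<^sup>2 / e) / 2)"
          using \<open>Q r \<ge> 0\<close> \<open>e > 0\<close> by (intro add_mono mult_left_mono norm_mult_le_weighted_mean)
        also have "\<dots> = (e * q f r + q g r / e) / 2"
          by (simp add: q_def algebra_simps add_divide_distrib)
        finally show "cmod (?h r) \<le> (e * q f r + q g r / e) / 2" .
      qed (use int(1) q(2)[OF f] q(2)[OF g] in auto)
      also have "\<dots> = (e * (sqrt (LINT r|radial_measure. q f r))\<^sup>2 + (sqrt (LINT r|radial_measure. q g r))\<^sup>2 / e) / 2"
        using q(2)[OF f] q(2)[OF g] q_int by simp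
      finally show "cmod (op_form radial_measure (L1_expr U) f g) \<le>
        (e * (sqrt (LINT r|radial_measure. q f r))\<^sup>2 + (sqrt (LINT r|radial_measure. q g r))\<^sup>2 / e) / 2" .
    qed (use q_int in auto)
  qed
qed simp

end

section \<open>Weyl sequences\<close>

lemma radial_L2_norm_le:
  assumes f: "Cc_half_line f" and "0 < a" "a \<le> b"
    and off: "\<And>r. r \<notin> {a..b} \<Longrightarrow> f r = 0" and le: "\<And>r. r \<in> {a..b} \<Longrightarrow> cmod (f r) \<le> d"
  shows "(L2_norm radial_measure f)\<^sup>2 \<le> b * (b - a) * d\<^sup>2"
proof -
  have meas: "(\<lambda>r. (cmod (f r))\<^sup>2) \<in> borel_measurable radial_measure"
    by (intro borel_measurable_radial Cc_half_line_continuous Cc_half_line_norm_sq f)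
  have "(L2_norm radial_measure f)\<^sup>2 = (LINT r|lborel. indicator {0<..} r *\<^sub>R (r *\<^sub>R (cmod (f r))\<^sup>2))"
    unfolding L2_norm_sq by (rule integral_radial[OF meas])
  also have "\<dots> \<le> (LINT r|lborel. indicator {a..b} r *\<^sub>R (b * d\<^sup>2))"
  proof (rule integral_mono)
    show "integrable lborel (\<lambda>r. indicator {0<..} r *\<^sub>R (r *\<^sub>R (cmod (f r))\<^sup>2))"
      using integrable_radial_iff[OF meas] integrable_radial[OF Cc_half_line_norm_sq[OF f]] by simp
    show "integrable lborel (\<lambda>r. indicator {a..b} r *\<^sub>R (b * d\<^sup>2))" by (intro borel_integrable_compact) auto
    fix r :: real
    show "indicator {0<..} r *\<^sub>R (r *\<^sub>R (cmod (f r))\<^sup>2) \<le> indicator {a..b} r *\<^sub>R (b * d\<^sup>2)"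
    proof (cases "r \<in> {a..b}")
      case True
      then show ?thesis using \<open>0 < a\<close> le[OF True] by (auto intro!: mult_mono power_mono)
    qed (use off in auto)
  qed
  also have "\<dots> = b * (b - a) * d\<^sup>2" using \<open>a \<le> b\<close> by simp
  finally show ?thesis .
qed

lemma radial_L2_norm_ge:
  assumes f: "Cc_half_line f" and "0 < a" "a \<le> b" "0 \<le> c"
    and ge: "\<And>r. r \<in> {a..b} \<Longrightarrow> cmod (f r) \<ge> c"
  shows "(L2_norm radial_measure f)\<^sup>2 \<ge> a * (b - a) * c\<^sup>2"
proof -
  have meas: "(\<lambda>r. (cmod (f r))\<^sup>2) \<in> borel_measurable radial_measure"
    by (intro borel_measurable_radial Cc_half_line_continuous Cc_half_line_norm_sq f)
  have "a * (b - a) * c\<^sup>2 = (LINT r|lborel. indicator {a..b} r *\<^sub>R (a * c\<^sup>2))" using \<open>a \<le> b\<close> by simp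
  also have "\<dots> \<le> (LINT r|lborel. indicator {0<..} r *\<^sub>R (r *\<^sub>R (cmod (f r))\<^sup>2))"
  proof (rule integral_mono)
    show "integrable lborel (\<lambda>r. indicator {0<..} r *\<^sub>R (r *\<^sub>R (cmod (f r))\<^sup>2))"
      using integrable_radial_iff[OF meas] integrable_radial[OF Cc_half_line_norm_sq[OF f]] by simp
    show "integrable lborel (\<lambda>r. indicator {a..b} r *\<^sub>R (a * c\<^sup>2))" by (intro borel_integrable_compact) auto
    fix r :: real
    show "indicator {a..b} r *\<^sub>R (a * c\<^sup>2) \<le> indicator {0<..} r *\<^sub>R (r *\<^sub>R (cmod (f r))\<^sup>2)"
    proof (cases "r \<in> {a..b}")
      case True
      then show ?thesis using \<open>0 < a\<close> \<open>0 \<le> c\<close> ge[OF True] by (auto intro!: mult_mono power_mono)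
    qed (auto simp: indicator_def)
  qed
  also have "\<dots> = (L2_norm radial_measure f)\<^sup>2"
    unfolding L2_norm_sq by (rule integral_radial[OF meas, symmetric])
  finally show ?thesis .
qed

text \<open>One parameter R is both the width of the packet and its distance from 0: as it grows,
  each derivative of the amplitude costs a factor 1/R and the support [R, 2R] moves to
  infinity.\<close>

definition wave_packet :: "real \<Rightarrow> real \<Rightarrow> real \<Rightarrow> complex" where
  "wave_packet k R r = of_real (bump (r / R - 1)) * cis (k * r)"

lemma wave_packet_test_function:
  assumes "R > 0"
  shows "wave_packet k R \<in> test_functions"
proof -
  have "smooth_on {0<..} (\<lambda>r. of_real (bump (1 / R * r + (- 1))) * cis (k * r))"
    by (intro smooth_on_mult smooth_on_of_real smooth_on_affine smooth_on_bump smooth_on_cis)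
  then have "smooth_on {0<..} (wave_packet k R)" by (simp add: wave_packet_def[abs_def])
  moreover have "wave_packet k R r = 0" if "r \<notin> {R..2 * R}" for r
    using that assms bump_eq_0[of "r / R - 1"] by (auto simp: wave_packet_def field_simps)
  ultimately show ?thesis unfolding test_functions_def
    using assms by (auto intro!: exI[of _ "{R..2 * R}"])
qed

text \<open>Continuity on [0, 1] and vanishing outside give one constant B for the bump and both
  derivatives, which makes the error estimates uniform in R.\<close>

lemma bump_derivs:
  obtains b1 b2 :: "real \<Rightarrow> real" and B where
    "\<And>x. (bump has_real_derivative b1 x) (at x)" "\<And>x. (b1 has_real_derivative b2 x) (at x)"
    "\<And>x. \<bar>bump x\<bar> \<le> B" "\<And>x. \<bar>b1 x\<bar> \<le> B" "\<And>x. \<bar>b2 x\<bar> \<le> B"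
    "\<And>x. x \<notin> {0..1} \<Longrightarrow> b1 x = 0" "\<And>x. x \<notin> {0..1} \<Longrightarrow> b2 x = 0"
proof -
  obtain D where D0: "D 0 = bump" and D: "\<And>k x. (D k has_vector_derivative D (Suc k) x) (at x)"
    using smooth_on_bump[of UNIV] unfolding smooth_on_def by auto
  have off: "D k x = 0" if "x \<notin> {0..1}" for k x
    using that
  proof (induction k arbitrary: x)
    case (Suc k)
    have "(D k has_vector_derivative 0) (at x)"
      by (rule has_vector_derivative_0_off_support[of "{0..1}"]) (use Suc in auto)
    then show ?case using D[of k x] by (rule vector_derivative_unique_at[rotated])
  qed (simp add: D0 bump_eq_0)
  have "\<exists>B. \<forall>x. \<bar>D k x\<bar> \<le> B" for k
  proof -
    have "continuous_on {0..1} (D k)"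
      using has_vector_derivative_continuous[OF D] by (auto intro!: continuous_at_imp_continuous_on)
    then have "bounded (D k ` {0..1})" by (intro compact_imp_bounded compact_continuous_image) auto
    then obtain B where "\<forall>x\<in>{0..1}. \<bar>D k x\<bar> \<le> B" by (auto simp: bounded_iff)
    then have "\<bar>D k x\<bar> \<le> max B 0" for x using off[of x k] by (cases "x \<in> {0..1}") fastforce+
    then show ?thesis by blast
  qed
  then obtain B where B: "\<And>k x. \<bar>D k x\<bar> \<le> B k" by metis
  show ?thesis
    by (rule that[of "D 1" "D 2" "max (B 0) (max (B 1) (B 2))"])
      (use D[of 0] D[of 1] B[of 0] B[of 1] B[of 2] off
        in \<open>auto simp: D0 has_real_derivative_iff_has_vector_derivative numeral_2_eq_2 le_max_iff_disj\<close>)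
qed

context vortex
begin

lemma L1_op_test_function: "f \<in> test_functions \<Longrightarrow> L1_op U f (L1_expr U f)"
  unfolding L1_op_def by (rule form_op_extends)

text \<open>Far out the operator is close to -d^2/dr^2 + 2, which multiplies cis(k r) by 2 + k^2. A
  pointwise bound is enough, because packet and error live on the same interval.\<close>

lemma wave_packet_almost_eigenfunction:
  assumes "\<delta> > 0"
  obtains R where "R > 0" "\<And>r. r \<in> {R..2 * R} \<Longrightarrow>
    cmod (L1_expr U (wave_packet k R) r - of_real (2 + k\<^sup>2) * wave_packet k R r) \<le> \<delta>"
    "\<And>r. r \<notin> {R..2 * R} \<Longrightarrow> L1_expr U (wave_packet k R) r - of_real (2 + k\<^sup>2) * wave_packet k R r = 0"
proof -
  obtain b1 b2 B where b: "\<And>x. (bump has_real_derivative b1 x) (at x)"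
    "\<And>x. (b1 has_real_derivative b2 x) (at x)"
    and B: "\<And>x. \<bar>bump x\<bar> \<le> B" "\<And>x. \<bar>b1 x\<bar> \<le> B" "\<And>x. \<bar>b2 x\<bar> \<le> B"
    and off: "\<And>x. x \<notin> {0..1} \<Longrightarrow> b1 x = 0" "\<And>x. x \<notin> {0..1} \<Longrightarrow> b2 x = 0"
    using bump_derivs by blast
  have "B \<ge> 0" using B(1)[of 0] by linarith
  have "(U \<longlongrightarrow> 1) at_top" by (rule vortex_profileE[OF vortex])
  then have "((\<lambda>r. B * (3 * \<bar>(U r)\<^sup>2 - 1\<bar>)) \<longlongrightarrow> B * (3 * \<bar>1\<^sup>2 - 1\<bar>)) at_top"
    by (intro tendsto_intros)
  then have "\<forall>\<^sub>F r in at_top. B * (3 * \<bar>(U r)\<^sup>2 - 1\<bar>) < \<delta> / 2"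
    using assms by (intro order_tendstoD) auto
  then obtain R0 where R0: "\<And>r. r \<ge> R0 \<Longrightarrow> B * (3 * \<bar>(U r)\<^sup>2 - 1\<bar>) < \<delta> / 2"
    by (auto simp: eventually_at_top_linorder)
  \<comment> \<open>The errors from derivatives of the amplitude, from the 1/r term and from 1/r^2
    add up to at most B (3 + 3 |k|) / R, that is, \<open>\<delta>\<close> / 2; R0 leaves the other
    half to U^2 - 1. R >= 1 gives R <= R^2, R r, r^2, so that every denominator may be replaced by
    R.\<close>
  define R where "R = max (max R0 1) (2 * B * (3 + 3 * \<bar>k\<bar>) / \<delta>)"
  have "R \<ge> 1" by (simp add: R_def)
  have R: "B * ((3 + 3 * \<bar>k\<bar>) / R + 3 * \<bar>(U r)\<^sup>2 - 1\<bar>) \<le> \<delta>" if "r \<in> {R..2 * R}" for r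
  proof -
    have "2 * B * (3 + 3 * \<bar>k\<bar>) / \<delta> \<le> R" by (simp add: R_def)
    then have "B * ((3 + 3 * \<bar>k\<bar>) / R) \<le> \<delta> / 2" using assms \<open>R \<ge> 1\<close> by (simp add: field_simps)
    moreover have "B * (3 * \<bar>(U r)\<^sup>2 - 1\<bar>) < \<delta> / 2" using that by (intro R0) (auto simp: R_def)
    ultimately show ?thesis unfolding distrib_left[of B] by linarith
  qed
  let ?x = "\<lambda>r. r / R - 1" and ?f = "wave_packet k R"
  define f1 where "f1 r = (of_real (b1 (?x r) / R) + \<i> * k * of_real (bump (?x r))) * cis (k * r)" for r
  define f2 where "f2 r = (of_real (b2 (?x r) / R\<^sup>2) + 2 * \<i> * k * of_real (b1 (?x r) / R)
      - of_real (k\<^sup>2 * bump (?x r))) * cis (k * r)" for r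
  have dcis: "((\<lambda>r. cis (k * r)) has_vector_derivative (\<i> * k) * cis (k * r)) (at r)" for r
    by (auto intro!: derivative_eq_intros simp: has_vector_derivative_def scaleR_conv_of_real)
  have dof_real: "((\<lambda>r. complex_of_real (h (?x r))) has_vector_derivative of_real (h' (?x r) / R)) (at r)"
    if "\<And>x. (h has_real_derivative h' x) (at x)" for h h' r
  proof -
    have "((\<lambda>r. h (?x r)) has_real_derivative h' (?x r) * (1 / R)) (at r)"
      by (rule DERIV_chain2[OF that]) (use \<open>R \<ge> 1\<close> in \<open>auto intro!: derivative_eq_intros\<close>)
    then have "((\<lambda>r. h (?x r)) has_vector_derivative h' (?x r) / R) (at r)"
      by (simp add: has_real_derivative_iff_has_vector_derivative)
    then show ?thesis by (rule bounded_linear.has_vector_derivative[OF bounded_linear_of_real])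
  qed
  have df: "(?f has_vector_derivative f1 r) (at r)" for r
    unfolding wave_packet_def[abs_def]
    using has_vector_derivative_mult[OF dof_real[OF b(1)] dcis]
    by (rule back_subst[where P = "\<lambda>d. (_ has_vector_derivative d) _"]) (simp add: f1_def algebra_simps)
  have df1: "(f1 has_vector_derivative f2 r) (at r)" for r
  proof -
    have "((\<lambda>r. of_real (1 / R) * of_real (b1 (?x r)) + (\<i> * k) * of_real (bump (?x r))) has_vector_derivative
        (of_real (1 / R) * of_real (b2 (?x r) / R) + (\<i> * k) * of_real (b1 (?x r) / R))) (at r)"
      by (intro has_vector_derivative_add has_vector_derivative_mult_right dof_real b)
    from has_vector_derivative_mult[OF this dcis]
    show ?thesis unfolding f1_def[abs_def]
      by (rule back_subst[where P = "\<lambda>d. d"])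
        (intro arg_cong2[where f = "\<lambda>f d. (f has_vector_derivative d) (at r)"] ext;
          simp add: f2_def algebra_simps power2_eq_square)
  qed
  have L1: "L1_expr U ?f r = - f2 r - of_real (1 / r) * f1 r + of_real (1 / r\<^sup>2) * ?f r
      - of_real (1 - 3 * (U r)\<^sup>2) * ?f r" for r
  proof -
    have "(\<lambda>s. vector_derivative ?f (at s)) = f1" using df by (auto intro!: ext vector_derivative_at)
    then show ?thesis using df[of r] df1[of r] by (simp add: L1_expr_def vector_derivative_at)
  qed
  have eq: "L1_expr U ?f r - of_real (2 + k\<^sup>2) * ?f r =
      (of_real (- b2 (?x r) / R\<^sup>2) - 2 * \<i> * k * of_real (b1 (?x r) / R) - of_real (b1 (?x r) / (R * r))
       - \<i> * k * of_real (bump (?x r) / r) + of_real (bump (?x r) / r\<^sup>2)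
       + of_real (3 * ((U r)\<^sup>2 - 1) * bump (?x r))) * cis (k * r)" if "r > 0" for r
    unfolding L1 using that \<open>R \<ge> 1\<close>
    by (simp add: f1_def f2_def wave_packet_def field_simps power2_eq_square)
  show ?thesis
  proof (rule that)
    show "R > 0" using \<open>R \<ge> 1\<close> by simp
    show "L1_expr U ?f r - of_real (2 + k\<^sup>2) * ?f r = 0" if "r \<notin> {R..2 * R}" for r
    proof -
      have "?x r \<notin> {0..1}" using that \<open>R \<ge> 1\<close> by (auto simp: field_simps)
      then show ?thesis unfolding L1 f1_def f2_def wave_packet_def using off bump_eq_0 by simp
    qed
    show "cmod (L1_expr U ?f r - of_real (2 + k\<^sup>2) * ?f r) \<le> \<delta>" if r: "r \<in> {R..2 * R}" for r
    proof -
      have "r > 0" "r \<ge> R" "R > 0" using r \<open>R \<ge> 1\<close> by auto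
      have le: "\<bar>h\<bar> / q \<le> B / R" if "\<bar>h\<bar> \<le> B" "q \<ge> R" for h q
        using that \<open>R > 0\<close> \<open>B \<ge> 0\<close> by (intro frac_le) auto
      have sq: "R\<^sup>2 \<ge> R" "R * r \<ge> R" "r\<^sup>2 \<ge> R"
        using \<open>R \<ge> 1\<close> \<open>r \<ge> R\<close> mult_mono[of R r 1 r] mult_mono[of 1 R R R] mult_mono[of 1 R R r]
        by (auto simp: power2_eq_square)
      have U3: "\<bar>3 * (U r)\<^sup>2 - 3\<bar> = 3 * \<bar>(U r)\<^sup>2 - 1\<bar>" by (simp add: abs_if)
      have "cmod (L1_expr U ?f r - of_real (2 + k\<^sup>2) * ?f r) \<le>
        \<bar>b2 (?x r)\<bar> / R\<^sup>2 + 2 * \<bar>k\<bar> * (\<bar>b1 (?x r)\<bar> / R) + \<bar>b1 (?x r)\<bar> / (R * r)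
        + \<bar>k\<bar> * (\<bar>bump (?x r)\<bar> / r) + \<bar>bump (?x r)\<bar> / r\<^sup>2 + 3 * \<bar>(U r)\<^sup>2 - 1\<bar> * \<bar>bump (?x r)\<bar>"
        unfolding eq[OF \<open>r > 0\<close>] norm_mult norm_cis mult_1_right
        by (intro order_trans[OF norm_triangle_ineq] order_trans[OF norm_triangle_ineq4] add_mono)
          (use \<open>R > 0\<close> \<open>r > 0\<close> in \<open>auto simp: norm_mult norm_divide abs_mult norm_power U3
            simp flip: of_real_mult of_real_diff of_real_power of_real_divide of_real_minus\<close>)
      also have "\<dots> \<le> B / R + 2 * \<bar>k\<bar> * (B / R) + B / R + \<bar>k\<bar> * (B / R) + B / R + 3 * \<bar>(U r)\<^sup>2 - 1\<bar> * B"
        using B sq \<open>r \<ge> R\<close> by (intro add_mono mult_left_mono le) auto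
      also have "\<dots> = B * ((3 + 3 * \<bar>k\<bar>) / R + 3 * \<bar>(U r)\<^sup>2 - 1\<bar>)"
        using \<open>R > 0\<close> by (simp add: field_simps)
      also have "\<dots> \<le> \<delta>" using R r by blast
      finally show ?thesis .
    qed
  qed
qed

text \<open>It is the bounded inverse that fails: for any candidate constant C there is a wave
  packet with k^2 = x - 2 whose error is too small for it.\<close>

lemma spectrum_L1_op:
  assumes "x > 2"
  shows "of_real x \<in> spectrum radial_measure (L1_op U)"
proof (rule ccontr)
  assume "of_real x \<notin> spectrum radial_measure (L1_op U)"
  then obtain C where C: "\<And>u w. L1_op U u w \<Longrightarrow>
      L2_norm radial_measure u \<le> C * L2_norm radial_measure (\<lambda>r. w r - of_real x * u r)"
    by (auto simp: spectrum_def resolvent_set_def)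
  define k where "k = sqrt (x - 2)"
  have x: "x = 2 + k\<^sup>2" using assms by (simp add: k_def)
  \<comment> \<open>The constant C may be zero or negative; c is positive and dominates |C|.\<close>
  define c where "c = \<bar>C\<bar> + 1"
  have "c > 0" by (simp add: c_def)
  \<comment> \<open>The squared norm of the packet is at least 4/9 R^2 exp(-6)^2, from its middle
    third, and that of the error at most 2 R^2 \<open>\<delta>\<close>^2. With this
    \<open>\<delta>\<close> the assumed bound would give 4/9 <= 2/9.\<close>
  define \<delta> where "\<delta> = exp (- 6) / (3 * c)"
  have "\<delta> > 0" using \<open>c > 0\<close> by (simp add: \<delta>_def)
  then obtain R where R: "R > 0" "\<And>r. r \<in> {R..2 * R} \<Longrightarrow>
      cmod (L1_expr U (wave_packet k R) r - of_real x * wave_packet k R r) \<le> \<delta>"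
    "\<And>r. r \<notin> {R..2 * R} \<Longrightarrow> L1_expr U (wave_packet k R) r - of_real x * wave_packet k R r = 0"
    using wave_packet_almost_eigenfunction[of \<delta> k] unfolding x by blast
  define f where "f = wave_packet k R"
  define w where "w r = L1_expr U f r - of_real x * f r" for r
  have test: "f \<in> test_functions" unfolding f_def using R(1) by (rule wave_packet_test_function)
  have w: "Cc_half_line w" unfolding w_def[abs_def]
    by (intro Cc_half_line_diff Cc_half_line_mult Cc_L1_expr test test_functions_deriv continuous_intros)
  have wle: "(L2_norm radial_measure w)\<^sup>2 \<le> 2 * R * (2 * R - R) * \<delta>\<^sup>2"
    by (rule radial_L2_norm_le[OF w]) (use R in \<open>auto simp: w_def f_def\<close>)
  have fge: "(4 / 3 * R) * (5 / 3 * R - 4 / 3 * R) * (exp (- 6))\<^sup>2 \<le> (L2_norm radial_measure f)\<^sup>2"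
  proof (rule radial_L2_norm_ge)
    show "Cc_half_line f" by (rule test_functions_deriv(1)[OF test])
    show "exp (- 6) \<le> cmod (f r)" if "r \<in> {4 / 3 * R..5 / 3 * R}" for r
    proof -
      have "r / R - 1 \<in> {1 / 3..2 / 3}" using that R(1) by (auto simp: field_simps)
      from bump_ge[OF this] show ?thesis by (simp add: f_def wave_packet_def norm_mult)
    qed
  qed (use R(1) in auto)
  have "L2_norm radial_measure f \<le> \<bar>C\<bar> * L2_norm radial_measure w"
    using C[OF L1_op_test_function[OF test]] mult_right_mono[OF abs_ge_self[of C] L2_norm_nonneg[of radial_measure w]]
    by (simp add: w_def[abs_def])
  then have "(L2_norm radial_measure f)\<^sup>2 \<le> (\<bar>C\<bar> * L2_norm radial_measure w)\<^sup>2"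
    by (intro power_mono) auto
  also have "\<dots> \<le> c\<^sup>2 * (2 * R * (2 * R - R) * \<delta>\<^sup>2)"
    unfolding power_mult_distrib by (intro mult_mono power_mono wle) (auto simp: c_def)
  also have "\<dots> = 2 / 9 * R\<^sup>2 * (exp (- 6))\<^sup>2"
    using \<open>c > 0\<close> by (simp add: \<delta>_def field_simps power2_eq_square)
  finally have "4 / 9 * (R\<^sup>2 * (exp (- 6))\<^sup>2) \<le> 2 / 9 * (R\<^sup>2 * (exp (- 6))\<^sup>2)"
    using fge by (simp add: algebra_simps power2_eq_square)
  moreover have "R\<^sup>2 * (exp (- 6))\<^sup>2 > 0" using R(1) by (intro mult_pos_pos) auto
  ultimately show False by linarith
qed

lemma discrete_spectrum_L1_op:
  "discrete_spectrum radial_measure (L1_op U) \<subseteq> of_real ` {67 / 50..<2}"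
proof
  fix z assume z: "z \<in> discrete_spectrum radial_measure (L1_op U)"
  then obtain x where x: "z = of_real x" "x \<ge> 67 / 50"
    using eigenvalue_form_op_ge by (auto simp: discrete_spectrum_def L1_op_def)
  have "x < 2"
  proof (rule ccontr)
    assume "\<not> x < 2"
    from z obtain T where T: "open T" "T \<inter> spectrum radial_measure (L1_op U) = {z}"
      by (auto simp: discrete_spectrum_def isolated_in_def)
    then obtain e where e: "e > 0" "ball z e \<subseteq> T" by (metis Int_iff insertI1 open_contains_ball)
    \<comment> \<open>The shift to the right lands strictly above 2 even when x = 2, and this second
      spectral point near z contradicts isolation.\<close>
    have "complex_of_real (x + e / 2) \<in> T"
      using e by (auto simp: x dist_norm norm_divide intro!: subsetD[OF e(2)])
    moreover have "complex_of_real (x + e / 2) \<in> spectrum radial_measure (L1_op U)"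
      using \<open>\<not> x < 2\<close> e(1) by (intro spectrum_L1_op) auto
    ultimately have "complex_of_real (x + e / 2) = z" using T(2) by blast
    then show False using e(1) unfolding x of_real_eq_iff by simp
  qed
  then show "z \<in> of_real ` {67 / 50..<2}" using x by auto
qed

end

theorem theorem6p2:
  fixes U :: "real \<Rightarrow> real"
  assumes "vortex_profile U"
  shows "discrete_spectrum radial_measure (L1_op U)
           \<subseteq> complex_of_real ` {1.3326<..<2}"
proof -
  interpret vortex U by standard (rule assms)
  show ?thesis using discrete_spectrum_L1_op by force
qed

end
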